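(* Let $n \ge 3$ be an integer, let $p$ be a real number with $1 < p \le \frac{n+2}{n-2}$, and let $q = \frac{2p}{p+1}$. Then for every real $M > 0$, the only nonnegative solution $v$ on $\mathbb{R}^n$ of $$\Delta v + v^p + M|\nabla v|^q = 0 \quad \text{in } \mathbb{R}^n$$ is $v \equiv 0$.
   Context: A solution is a global classical solution: a function $v \in C^2(\mathbb{R}^n)$ satisfying the equation at every point of $\mathbb{R}^n$. Nonnegative means $v(x) \ge 0$ for all $x$. No condition on the behaviour of $v$ at infinity is imposed. *)

theory Defs
  imports "HOL-Analysis.Analysis"
begin

text \<open>Directional derivative along the \<open>i\<close>-th standard basis vector, expressed through the total
  derivative; it is meaningful only at points where \<open>f\<close> is differentiable, which
  \<open>C2\<close> below guarantees wherever it is used.\<close>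

definition partial_deriv :: "'n::finite \<Rightarrow> (real ^ 'n \<Rightarrow> real) \<Rightarrow> real ^ 'n \<Rightarrow> real" where
  "partial_deriv i f x = frechet_derivative f (at x) (axis i 1)"

definition grad :: "(real ^ 'n::finite \<Rightarrow> real) \<Rightarrow> real ^ 'n \<Rightarrow> real ^ 'n" where
  "grad f x = (\<chi> i. partial_deriv i f x)"

definition laplacian :: "(real ^ 'n::finite \<Rightarrow> real) \<Rightarrow> real ^ 'n \<Rightarrow> real" where
  "laplacian f x = (\<Sum>i\<in>UNIV. partial_deriv i (partial_deriv i f) x)"

text \<open>Continuity of \<open>f\<close> and of its first partial derivatives need not be listed: it follows
  from their differentiability.\<close>

definition C2 :: "(real ^ 'n::finite \<Rightarrow> real) \<Rightarrow> bool" where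
  "C2 f \<longleftrightarrow>
     f differentiable_on UNIV \<and>
     (\<forall>i. partial_deriv i f differentiable_on UNIV) \<and>
     (\<forall>i j. continuous_on UNIV (partial_deriv j (partial_deriv i f)))"

text \<open>The power \<open>powr\<close> agrees with the usual real power on nonnegative bases for positive
  exponents (in particular \<open>0 powr a = 0\<close>), the only case in which it is used: \<open>v\<close> will be
  nonnegative and \<open>p, q > 0\<close>.\<close>

definition classical_solution ::
    "real \<Rightarrow> real \<Rightarrow> real \<Rightarrow> (real ^ 'n::finite \<Rightarrow> real) \<Rightarrow> bool" where
  "classical_solution p q M v \<longleftrightarrow>
     C2 v \<and> (\<forall>x. laplacian v x + v x powr p + M * norm (grad v x) powr q = 0)"

end

theory Submission
  imports Defs
begin

text \<open>
Suppose that a nonnegative solution \<open>v\<close> is not identically zero. It is superharmonic, so the strong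
minimum principle (\<open>strong_minimum_principle\<close>) makes it positive everywhere, and powers of \<open>v\<close> with
negative exponents may be used as weights. The exponent \<open>q\<close> is the one for which the equation is
invariant under scaling: in terms of the scale invariant quantity \<open>x = |\<nabla>v|\<^sup>2 / v\<^sup>p\<^sup>+\<^sup>1\<close> it reads
\<open>\<Delta>v = - v\<^sup>p F(x)\<close> with the concave function \<open>F(x) = 1 + M x\<^sup>s\<close>, \<open>s = p / (p + 1)\<close>.

The proof is an integral estimate in the spirit of Obata and of Gidas and Spruck. The integrated
Bochner identity (\<open>weak_bochner\<close>) is tested with \<open>v\<^sup>\<kappa>\<^sup>-\<^sup>p \<eta>\<close> and the weak form of the Laplacian
(\<open>weak_laplacian\<close>) with \<open>v\<^sup>\<kappa> h(x) \<eta>\<close>, where \<open>\<eta>\<close> is a cutoff function, \<open>\<kappa> = p n / (n + 2)\<close> and \<open>h\<close> is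
at our disposal. By \<open>integrand_eq\<close>, the sum of the two integrands is \<open>v\<^sup>\<kappa>\<^sup>+\<^sup>p \<eta> Q\<close> plus terms with
\<open>\<nabla>\<eta>\<close>, where \<open>Q\<close> is quadratic in the rescaled Hessian. Completing the square (\<open>Q_eq\<close>) leaves a function
\<open>reaction x\<close> of the single variable \<open>x\<close>, and everything depends on its positivity.

Take \<open>h(x) = - m F(x\<^sub>1) - m \<kappa> x\<close> with \<open>m = (n - 1) / n\<close>, where \<open>x\<^sub>1\<close> is the point at which \<open>F\<close> crosses the
line \<open>\<kappa> x\<close>. Then the remainder is \<open>m (F(x) - \<kappa> x) (F(x\<^sub>1) - F(x)) + \<beta> x\<^sup>2\<close>, and \<open>\<beta> \<ge> 0\<close> says precisely
that \<open>p\<close> does not exceed the critical exponent. As \<open>F\<close> is increasing and \<open>F(x) / x\<close> is decreasing, both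
factors of the product change sign exactly at \<open>x\<^sub>1\<close>, so the remainder is nonnegative. At \<open>x = 0\<close> it
equals \<open>m (F(x\<^sub>1) - 1)\<close>, which is positive only because \<open>M > 0\<close>; this is how the gradient term
excludes the explicit positive solutions that exist for \<open>M = 0\<close> and critical \<open>p\<close>. For critical \<open>p\<close> the
remainder still vanishes at \<open>x\<^sub>1\<close> and grows more slowly than \<open>x\<^sup>2\<close>. A small perturbation \<open>\<theta>\<close> of \<open>h\<close> cures
both defects and gives \<open>reaction x \<ge> \<delta> (1 + x\<^sup>2)\<close> (\<open>reaction_coercive\<close>), hence control of the whole
Hessian (\<open>Q_coercive\<close>).

With this coercivity, Young's inequality absorbs the terms with \<open>\<nabla>\<eta>\<close>. For a cutoff function at scale
\<open>R\<close> the outcome (\<open>energy_estimate\<close>) is that the integral of \<open>\<eta> v\<^sup>\<kappa>\<^sup>+\<^sup>p\<close> is at most a constant times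
\<open>R\<^sup>n\<^sup>-\<^sup>K\<close> with \<open>K = 2 (\<kappa> + p) / (p - 1) \<ge> n + 1\<close>. Letting \<open>R\<close> tend to infinity contradicts \<open>v > 0\<close>.

Solutions are only of class C2, so the Bochner identity, whose usual derivation uses third
derivatives, is obtained from a symmetry of \<open>\<integral> \<partial>\<^sub>d w \<partial>\<^sub>e u\<close> in the two directions that holds for
functions with one continuous derivative (\<open>integral_swap_derivatives\<close>).
\<close>

section \<open>Functions with a continuous gradient\<close>

text \<open>The gradient is carried along as an explicit vector field, because the integrands below are algebraic
expressions in it.\<close>

definition has_cont_grad :: "('a::euclidean_space \<Rightarrow> real) \<Rightarrow> ('a \<Rightarrow> 'a) \<Rightarrow> bool" where
  "has_cont_grad f g \<longleftrightarrow>
     (\<forall>x. (f has_derivative (\<lambda>h. g x \<bullet> h)) (at x)) \<and> continuous_on UNIV g"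

lemma has_cont_gradD:
  assumes "has_cont_grad f g"
  shows "(f has_derivative (\<lambda>h. g x \<bullet> h)) (at x)"
    and "continuous_on S g" and "continuous_on S f"
proof -
  show d: "(f has_derivative (\<lambda>h. g x \<bullet> h)) (at x)" for x
    using assms by (simp add: has_cont_grad_def)
  show "continuous_on S g"
    using assms continuous_on_subset by (auto simp: has_cont_grad_def)
  show "continuous_on S f"
    by (meson d has_derivative_continuous continuous_at_imp_continuous_on)
qed

lemma has_cont_grad_mult:
  assumes "has_cont_grad f f'" "has_cont_grad g g'"
  shows "has_cont_grad (\<lambda>x. f x * g x) (\<lambda>x. f x *\<^sub>R g' x + g x *\<^sub>R f' x)"
  unfolding has_cont_grad_def
proof (intro conjI allI)
  show "((\<lambda>x. f x * g x) has_derivative (\<lambda>h. (f x *\<^sub>R g' x + g x *\<^sub>R f' x) \<bullet> h)) (at x)" for x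
    by (rule derivative_eq_intros has_cont_gradD[OF assms(1)] has_cont_gradD[OF assms(2)] refl)+
       (simp add: fun_eq_iff inner_add_left algebra_simps)
  show "continuous_on UNIV (\<lambda>x. f x *\<^sub>R g' x + g x *\<^sub>R f' x)"
    by (intro continuous_intros has_cont_gradD[OF assms(1)] has_cont_gradD[OF assms(2)])
qed

lemma has_cont_grad_add:
  assumes "has_cont_grad f f'" "has_cont_grad g g'"
  shows "has_cont_grad (\<lambda>x. f x + g x) (\<lambda>x. f' x + g' x)"
  unfolding has_cont_grad_def
proof (intro conjI allI)
  show "((\<lambda>x. f x + g x) has_derivative (\<lambda>h. (f' x + g' x) \<bullet> h)) (at x)" for x
    by (rule derivative_eq_intros has_cont_gradD[OF assms(1)] has_cont_gradD[OF assms(2)] refl)+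
       (simp add: fun_eq_iff inner_add_left algebra_simps)
  show "continuous_on UNIV (\<lambda>x. f' x + g' x)"
    by (intro continuous_intros has_cont_gradD[OF assms(1)] has_cont_gradD[OF assms(2)])
qed

lemma has_cont_grad_const: "has_cont_grad (\<lambda>_. c) (\<lambda>_. 0)"
  by (simp add: has_cont_grad_def)

lemma has_cont_grad_sum:
  assumes "\<And>i. i \<in> I \<Longrightarrow> has_cont_grad (f i) (g i)"
  shows "has_cont_grad (\<lambda>x. \<Sum>i\<in>I. f i x) (\<lambda>x. \<Sum>i\<in>I. g i x)"
  using assms
  by (induction I rule: infinite_finite_induct) (auto intro: has_cont_grad_const has_cont_grad_add)

lemma has_cont_grad_compose:
  assumes f: "has_cont_grad f f'"
    and h: "\<And>x. (h has_real_derivative h' (f x)) (at (f x))"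
    and "continuous_on (range f) h'"
  shows "has_cont_grad (\<lambda>x. h (f x)) (\<lambda>x. h' (f x) *\<^sub>R f' x)"
  unfolding has_cont_grad_def
proof (intro conjI allI)
  show "((\<lambda>x. h (f x)) has_derivative (\<lambda>k. (h' (f x) *\<^sub>R f' x) \<bullet> k)) (at x)" for x
    using has_derivative_compose[OF has_cont_gradD(1)[OF f] h[of x, unfolded has_field_derivative_def]]
    by simp
  show "continuous_on UNIV (\<lambda>x. h' (f x) *\<^sub>R f' x)"
    using assms(3)
    by (intro continuous_intros has_cont_gradD[OF f] continuous_on_compose2[OF assms(3)]) auto
qed

lemma partial_deriv_eq:
  assumes "(f has_derivative f') (at x)"
  shows "partial_deriv i f x = f' (axis i 1)"
  using frechet_derivative_at[OF assms] by (simp add: partial_deriv_def)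

lemma differentiable_imp_has_cont_grad:
  fixes f :: "real ^ 'n::finite \<Rightarrow> real"
  assumes "f differentiable_on UNIV" "\<And>i. continuous_on UNIV (partial_deriv i f)"
  shows "has_cont_grad f (grad f)"
  unfolding has_cont_grad_def
proof (intro conjI allI)
  fix x
  have d: "(f has_derivative frechet_derivative f (at x)) (at x)"
    using assms(1) by (simp add: differentiable_on_def frechet_derivative_works)
  have "frechet_derivative f (at x) h = grad f x \<bullet> h" for h
  proof -
    have "frechet_derivative f (at x) h = frechet_derivative f (at x) (\<Sum>i\<in>UNIV. h $ i *\<^sub>R axis i 1)"
      by (simp add: basis_expansion flip: scalar_mult_eq_scaleR)
    also have "\<dots> = (\<Sum>i\<in>UNIV. h $ i * partial_deriv i f x)"
      unfolding partial_deriv_def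
      by (simp add: linear_sum[OF has_derivative_linear[OF d]] linear_cmul[OF has_derivative_linear[OF d]])
    also have "\<dots> = grad f x \<bullet> h"
      by (simp add: inner_vec_def grad_def mult.commute)
    finally show ?thesis .
  qed
  then show "(f has_derivative (\<lambda>h. grad f x \<bullet> h)) (at x)"
    using d by (metis (no_types, lifting) ext)
next
  show "continuous_on UNIV (grad f)"
    unfolding grad_def by (intro continuous_on_vec_lambda assms)
qed

lemma C2_imp_has_cont_grad:
  fixes v :: "real ^ 'n::finite \<Rightarrow> real"
  assumes "C2 v"
  shows "has_cont_grad v (grad v)"
    and "has_cont_grad (\<lambda>x. grad v x $ i) (grad (partial_deriv i v))"
proof -
  have "continuous_on UNIV (partial_deriv i v)" for i
    using assms differentiable_imp_continuous_on by (auto simp: C2_def)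
  then show "has_cont_grad v (grad v)"
    using assms by (intro differentiable_imp_has_cont_grad) (auto simp: C2_def)
  have "has_cont_grad (partial_deriv i v) (grad (partial_deriv i v))"
    using assms by (intro differentiable_imp_has_cont_grad) (auto simp: C2_def)
  then show "has_cont_grad (\<lambda>x. grad v x $ i) (grad (partial_deriv i v))"
    by (simp add: grad_def)
qed

section \<open>Integration by parts\<close>

lemma integrable_compact_support:
  fixes f :: "'a::euclidean_space \<Rightarrow> real"
  assumes "continuous_on UNIV f" "\<And>x. norm x > R \<Longrightarrow> f x = 0"
  shows "integrable lborel f"
proof -
  have "integrable lborel (\<lambda>x. indicator (cball 0 R) x *\<^sub>R f x)"
    by (rule borel_integrable_compact) (auto intro: continuous_on_subset[OF assms(1)])
  also have "(\<lambda>x. indicator (cball 0 R) x *\<^sub>R f x) = f"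
    using assms(2) by (auto simp: fun_eq_iff indicator_def)
  finally show ?thesis .
qed

lemma integral_lborel_translation:
  fixes f :: "'a::euclidean_space \<Rightarrow> real"
  assumes "continuous_on UNIV f"
  shows "(\<integral>x. f (x + c) \<partial>lborel) = (\<integral>x. f x \<partial>lborel)"
proof -
  have [measurable]: "f \<in> borel_measurable borel"
    using assms by (rule borel_measurable_continuous_onI)
  have "(\<integral>x. f x \<partial>lborel) = (\<integral>x. f x \<partial>distr lborel borel ((+) c))"
    by (simp add: lborel_distr_plus)
  also have "\<dots> = (\<integral>x. f (c + x) \<partial>lborel)"
    by (rule integral_distr) auto
  finally show ?thesis
    by (simp add: add.commute)
qed

lemma grad_bound_imp_lipschitz:
  assumes f: "has_cont_grad f g" and K: "\<And>x. x \<in> cball 0 R \<Longrightarrow> norm (g x) \<le> K"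
    and "x \<in> cball 0 R" "y \<in> cball 0 R"
  shows "\<bar>f x - f y\<bar> \<le> K * norm (x - y)"
proof -
  have "norm (f x - f y) \<le> K * norm (x - y)"
  proof (rule differentiable_bound[OF convex_cball _ _ assms(3,4)])
    fix z :: 'a assume z: "z \<in> cball 0 R"
    show "(f has_derivative (\<lambda>h. g z \<bullet> h)) (at z within cball 0 R)"
      using has_cont_gradD(1)[OF f] has_derivative_at_withinI by blast
    show "onorm (\<lambda>h. g z \<bullet> h) \<le> K"
    proof (rule onorm_bound)
      show "0 \<le> K" using K[OF z] norm_ge_zero order_trans by blast
      show "norm (g z \<bullet> h) \<le> K * norm h" for h
        using order_trans[OF Cauchy_Schwarz_ineq2 mult_right_mono[OF K[OF z] norm_ge_zero]] by simp
    qed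
  qed
  then show ?thesis by simp
qed

lemma difference_quotient_tendsto:
  fixes f :: "'a::euclidean_space \<Rightarrow> real"
  assumes "(f has_derivative (\<lambda>h. g \<bullet> h)) (at x)"
  shows "(\<lambda>k. real (Suc k) * (f (x + (1 / real (Suc k)) *\<^sub>R e) - f x)) \<longlonglongrightarrow> g \<bullet> e"
proof -
  have "((\<lambda>t. f (x + t *\<^sub>R e)) has_derivative (\<lambda>t. g \<bullet> (t *\<^sub>R e))) (at 0)"
  proof (rule has_derivative_compose[where f = "\<lambda>t. x + t *\<^sub>R e"])
    show "((\<lambda>t. x + t *\<^sub>R e) has_derivative (\<lambda>t. t *\<^sub>R e)) (at 0)"
      by (auto intro!: derivative_eq_intros)
    show "(f has_derivative (\<bullet>) g) (at (x + 0 *\<^sub>R e))"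
      using assms by simp
  qed
  then have "((\<lambda>t. f (x + t *\<^sub>R e)) has_real_derivative (g \<bullet> e)) (at 0)"
    by (rule has_derivative_imp_has_field_derivative) simp
  then have L: "((\<lambda>t. (f (x + t *\<^sub>R e) - f x) / t) \<longlongrightarrow> g \<bullet> e) (at 0)"
    by (simp add: has_field_derivative_iff)
  have "filterlim (\<lambda>k. 1 / real (Suc k)) (at 0) sequentially"
    using LIMSEQ_inverse_real_of_nat
    by (auto simp: filterlim_at inverse_eq_divide)
  from filterlim_compose[OF L this] show ?thesis
    by (simp add: field_simps)
qed

text \<open>Dominated convergence: on a bounded set the difference quotients are bounded by the maximum of the
gradient. The compact support may sit on either factor; \<open>integral_swap_derivatives\<close> needs both cases.\<close>

lemma integral_difference_quotient_tendsto:
  fixes f u :: "'a::euclidean_space \<Rightarrow> real"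
  assumes f: "has_cont_grad f g" and u: "continuous_on UNIV u"
    and supp: "(\<forall>x. norm x > R \<longrightarrow> f x = 0) \<or> (\<forall>x. norm x > R \<longrightarrow> u x = 0)"
  shows "(\<lambda>k. \<integral>x. u x * (real (Suc k) * (f (x + (1 / real (Suc k)) *\<^sub>R e) - f x)) \<partial>lborel)
           \<longlonglongrightarrow> (\<integral>x. u x * (g x \<bullet> e) \<partial>lborel)"
proof -
  define D where "D = (\<lambda>k x. real (Suc k) * (f (x + (1 / real (Suc k)) *\<^sub>R e) - f x))"
  define B where "B = (cball 0 (\<bar>R\<bar> + norm e) :: 'a set)"
  define B' where "B' = (cball 0 (\<bar>R\<bar> + 2 * norm e) :: 'a set)"
  have "compact (g ` B')" "compact (u ` B)"
    by (auto simp: B_def B'_def intro!: compact_continuous_image has_cont_gradD[OF f]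
        continuous_on_subset[OF u])
  then obtain K L where K: "\<And>x. x \<in> B' \<Longrightarrow> norm (g x) \<le> K" and L: "\<And>x. x \<in> B \<Longrightarrow> \<bar>u x\<bar> \<le> L"
    by (metis compact_imp_bounded bounded_iff imageI real_norm_def)
  have small: "norm ((1 / real (Suc k)) *\<^sub>R e) \<le> norm e" for k
    by (simp add: divide_simps mult_left_le_one_le) (simp add: algebra_simps)
  have cont_D: "continuous_on UNIV (D k)" for k
    unfolding D_def
    by (intro continuous_intros continuous_on_compose2[OF has_cont_gradD(3)[OF f, of UNIV]]) auto
  have [measurable]: "D k \<in> borel_measurable borel" "u \<in> borel_measurable borel"
    "(\<lambda>x. g x \<bullet> e) \<in> borel_measurable borel" for k
    by (auto intro!: borel_measurable_continuous_onI cont_D u continuous_intros has_cont_gradD[OF f])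
  have bound: "\<bar>u x * D k x\<bar> \<le> indicator B x * (L * (K * norm e))" for x k
  proof (cases "x \<in> B")
    case True
    have x: "norm x \<le> \<bar>R\<bar> + norm e"
      using True by (simp add: B_def)
    then have B'1: "x \<in> B'"
      using norm_ge_zero[of e] unfolding B'_def mem_cball_0 by linarith
    have B'2: "x + (1 / real (Suc k)) *\<^sub>R e \<in> B'"
      unfolding B'_def mem_cball_0
      using x small[of k] norm_triangle_ineq[of x "(1 / real (Suc k)) *\<^sub>R e"] by linarith
    note B' = B'1 B'2
    have "\<bar>f (x + (1 / real (Suc k)) *\<^sub>R e) - f x\<bar>
          \<le> K * norm (x + (1 / real (Suc k)) *\<^sub>R e - x)"
      using B' by (intro grad_bound_imp_lipschitz[OF f K[unfolded B'_def]]) (auto simp: B'_def)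
    also have "\<dots> = K * norm e / real (Suc k)"
      by (simp add: field_simps)
    finally have "real (Suc k) * \<bar>f (x + (1 / real (Suc k)) *\<^sub>R e) - f x\<bar> \<le> K * norm e"
      by (simp only: pos_le_divide_eq of_nat_0_less_iff zero_less_Suc mult.commute)
    then have "\<bar>D k x\<bar> \<le> K * norm e"
      unfolding D_def abs_mult by simp
    with L[OF True] show ?thesis
      using True by (auto simp: abs_mult intro!: mult_mono order_trans[OF abs_ge_zero L])
  next
    case False
    then have x: "norm x > \<bar>R\<bar> + norm e" by (simp add: B_def)
    have "norm x > R" using x norm_ge_zero[of e] by linarith
    have "norm (x + (1 / real (Suc k)) *\<^sub>R e) \<ge> norm x - norm ((1 / real (Suc k)) *\<^sub>R e)"
      by (rule norm_diff_ineq)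
    then have "norm (x + (1 / real (Suc k)) *\<^sub>R e) > R"
      using x small[of k] by linarith
    with \<open>norm x > R\<close> supp have "u x * D k x = 0"
      by (auto simp: D_def)
    then show ?thesis using False by simp
  qed
  have "(\<lambda>k. \<integral>x. u x * D k x \<partial>lborel) \<longlonglongrightarrow> (\<integral>x. u x * (g x \<bullet> e) \<partial>lborel)"
  proof (rule integral_dominated_convergence[where w = "\<lambda>x. indicator B x * (L * (K * norm e))"])
    show "integrable lborel (\<lambda>x. indicator B x * (L * (K * norm e)))"
      by (intro integrable_mult_left integrable_real_indicator) (simp_all add: B_def emeasure_compact_finite[OF compact_cball, unfolded infinity_ennreal_def])
    show "AE x in lborel. (\<lambda>k. u x * D k x) \<longlonglongrightarrow> u x * (g x \<bullet> e)"
      unfolding D_def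
      by (intro AE_I2 tendsto_intros difference_quotient_tendsto has_cont_gradD[OF f])
    show "AE x in lborel. norm (u x * D k x) \<le> indicator B x * (L * (K * norm e))" for k
      using bound by simp
  qed auto
  then show ?thesis by (simp add: D_def)
qed

text \<open>By translation invariance of Lebesgue measure the integrals of all difference quotients vanish.\<close>

lemma integral_directional_derivative_eq_0:
  fixes f :: "'a::euclidean_space \<Rightarrow> real"
  assumes f: "has_cont_grad f g" and supp: "\<And>x. norm x > R \<Longrightarrow> f x = 0"
  shows "(\<integral>x. g x \<bullet> e \<partial>lborel) = 0"
proof -
  have "(\<integral>x. f (x + c) - f x \<partial>lborel) = 0" for c
  proof -
    have "integrable lborel (\<lambda>x. f (x + c))"
    proof (rule integrable_compact_support[where R = "R + norm c"])
      show "continuous_on UNIV (\<lambda>x. f (x + c))"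
        by (intro continuous_on_compose2[OF has_cont_gradD(3)[OF f, of UNIV]] continuous_intros) auto
      fix x :: 'a assume "norm x > R + norm c"
      moreover have "norm (x + c) \<ge> norm x - norm c" by norm
      ultimately show "f (x + c) = 0" using supp by simp
    qed
    moreover have "integrable lborel f"
      using integrable_compact_support[OF has_cont_gradD(3)[OF f]] supp by blast
    ultimately show ?thesis
      by (simp add: integral_lborel_translation[OF has_cont_gradD(3)[OF f]])
  qed
  then have 0: "(\<integral>x. 1 * (real (Suc k) * (f (x + (1 / real (Suc k)) *\<^sub>R e) - f x)) \<partial>lborel) = 0" for k
    by simp
  have "(\<lambda>k. \<integral>x. 1 * (real (Suc k) * (f (x + (1 / real (Suc k)) *\<^sub>R e) - f x)) \<partial>lborel)
           \<longlonglongrightarrow> (\<integral>x. 1 * (g x \<bullet> e) \<partial>lborel)"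
    by (rule integral_difference_quotient_tendsto[OF f, where R = R]) (use supp in auto)
  then show ?thesis
    unfolding 0 by (simp add: LIMSEQ_const_iff)
qed

lemma grad_eq_0_outside_support:
  assumes f: "has_cont_grad f g" and supp: "\<And>x. norm x > R \<Longrightarrow> f x = 0" and "norm x > R"
  shows "g x = 0"
proof -
  have "open {x::'a. norm x > R}"
    by (rule open_Collect_less) (auto intro: continuous_intros)
  then have "((\<lambda>_. 0) has_derivative (\<lambda>h. g x \<bullet> h)) (at x)"
    using has_derivative_transform_within_open[OF has_cont_gradD(1)[OF f] \<open>open _\<close>, where g = "\<lambda>_. 0"] supp \<open>norm x > R\<close> by auto
  from has_derivative_unique[OF this has_derivative_const]
  have "g x \<bullet> g x = 0" by metis
  then show ?thesis by simp
qed

lemma integral_by_parts: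
  fixes u w :: "'a::euclidean_space \<Rightarrow> real"
  assumes u: "has_cont_grad u u'" and w: "has_cont_grad w w'"
    and supp: "\<And>x. norm x > R \<Longrightarrow> w x = 0"
  shows "(\<integral>x. w x * (u' x \<bullet> e) \<partial>lborel) = - (\<integral>x. (w' x \<bullet> e) * u x \<partial>lborel)"
proof -
  note supp' = grad_eq_0_outside_support[OF w supp]
  have 1: "integrable lborel (\<lambda>x. w x * (u' x \<bullet> e))" "integrable lborel (\<lambda>x. (w' x \<bullet> e) * u x)"
    by (rule integrable_compact_support[where R = R];
        auto intro!: continuous_intros has_cont_gradD[OF u] has_cont_gradD[OF w] simp: supp supp')+
  have "(\<integral>x. (w x *\<^sub>R u' x + u x *\<^sub>R w' x) \<bullet> e \<partial>lborel) = 0"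
    by (rule integral_directional_derivative_eq_0[OF has_cont_grad_mult[OF w u], where R = R])
       (simp add: supp)
  also have "(\<lambda>x. (w x *\<^sub>R u' x + u x *\<^sub>R w' x) \<bullet> e) = (\<lambda>x. w x * (u' x \<bullet> e) + (w' x \<bullet> e) * u x)"
    by (simp add: fun_eq_iff inner_add_left)
  finally show ?thesis
    using 1 by simp
qed

text \<open>For \<open>u\<close> of class C2 both sides equal the integral of \<open>- w \<partial>\<^sub>d \<partial>\<^sub>e u\<close>. For \<open>u\<close> of class C1 the same
computation is done with one derivative of \<open>u\<close> replaced by a difference quotient, which a translation
then moves over to \<open>w\<close>. Applied to first derivatives of \<open>v\<close>, this takes the place of third
derivatives of \<open>v\<close>.\<close>

lemma integral_swap_derivatives:
  fixes u w :: "'a::euclidean_space \<Rightarrow> real"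
  assumes u: "has_cont_grad u u'" and w: "has_cont_grad w w'"
    and supp: "\<And>x. norm x > R \<Longrightarrow> w x = 0"
  shows "(\<integral>x. (w' x \<bullet> d) * (u' x \<bullet> e) \<partial>lborel) = (\<integral>x. (w' x \<bullet> e) * (u' x \<bullet> d) \<partial>lborel)"
proof -
  note supp' = grad_eq_0_outside_support[OF w supp]
  define h where "h = (\<lambda>k. (1 / real (Suc k)) *\<^sub>R e)"
  note cu = has_cont_gradD(3)[OF u, of UNIV] and cu' = has_cont_gradD(2)[OF u, of UNIV]
  note cw = has_cont_gradD(3)[OF w, of UNIV] and cw' = has_cont_gradD(2)[OF w, of UNIV]
  have shift: "has_cont_grad (\<lambda>x. real (Suc k) * (u (x + h k) - u x))
      (\<lambda>x. real (Suc k) *\<^sub>R (u' (x + h k) - u' x))" for k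
    unfolding has_cont_grad_def
  proof (intro conjI allI)
    fix x
    have "((\<lambda>x. u (x + h k)) has_derivative (\<lambda>y. u' (x + h k) \<bullet> y)) (at x)"
      by (rule has_derivative_compose[OF _ has_cont_gradD(1)[OF u]]) (auto intro!: derivative_eq_intros)
    from has_derivative_mult_right[OF has_derivative_diff[OF this has_cont_gradD(1)[OF u]]]
    show "((\<lambda>x. real (Suc k) * (u (x + h k) - u x)) has_derivative
          (\<lambda>y. (real (Suc k) *\<^sub>R (u' (x + h k) - u' x)) \<bullet> y)) (at x)"
      by (simp add: inner_diff_left)
    show "continuous_on UNIV (\<lambda>x. real (Suc k) *\<^sub>R (u' (x + h k) - u' x))"
      by (intro continuous_intros continuous_on_compose2[OF cu'] cu') auto
  qed
  have eq: "(\<integral>x. (w' x \<bullet> d) * (real (Suc k) * (u (x + h k) - u x)) \<partial>lborel)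
      = - (\<integral>x. (u' x \<bullet> d) * (real (Suc k) * (w (x + (1 / real (Suc k)) *\<^sub>R (- e)) - w x)) \<partial>lborel)" for k
  proof -
    have hk: "(1 / real (Suc k)) *\<^sub>R (- e) = - h k" by (simp add: h_def)
    have I0: "integrable lborel (\<lambda>x. w x * (u' x \<bullet> d))"
      by (rule integrable_compact_support[where R = R]) (auto intro!: continuous_intros cw cu' simp: supp)
    have I1: "integrable lborel (\<lambda>x. w x * (u' (x + h k) \<bullet> d))"
      by (rule integrable_compact_support[where R = R])
         (auto intro!: continuous_intros cw continuous_on_compose2[OF cu'] simp: supp)
    have c2: "continuous_on UNIV (\<lambda>x. w (x - h k) * (u' x \<bullet> d))"
      by (auto intro!: continuous_intros cu' continuous_on_compose2[OF cw])
    have I2: "integrable lborel (\<lambda>x. w (x - h k) * (u' x \<bullet> d))"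
    proof (rule integrable_compact_support[where R = "R + norm (h k)"])
      fix x :: 'a assume "norm x > R + norm (h k)"
      moreover have "norm (x - h k) \<ge> norm x - norm (h k)" by norm
      ultimately show "w (x - h k) * (u' x \<bullet> d) = 0" using supp by simp
    qed (rule c2)
    have "- (\<integral>x. (w' x \<bullet> d) * (real (Suc k) * (u (x + h k) - u x)) \<partial>lborel)
        = (\<integral>x. w x * ((real (Suc k) *\<^sub>R (u' (x + h k) - u' x)) \<bullet> d) \<partial>lborel)"
      using integral_by_parts[OF shift[of k] w supp, where e = d] by simp
    also have "\<dots> = (\<integral>x. real (Suc k) * (w x * (u' (x + h k) \<bullet> d) - w x * (u' x \<bullet> d)) \<partial>lborel)"
      by (rule Bochner_Integration.integral_cong) (auto simp: inner_diff_left algebra_simps)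
    also have "\<dots> = real (Suc k) * ((\<integral>x. w x * (u' (x + h k) \<bullet> d) \<partial>lborel) - (\<integral>x. w x * (u' x \<bullet> d) \<partial>lborel))"
      using I0 I1 by simp
    also have "(\<integral>x. w x * (u' (x + h k) \<bullet> d) \<partial>lborel) = (\<integral>x. w (x - h k) * (u' x \<bullet> d) \<partial>lborel)"
      using integral_lborel_translation[OF c2, of "h k"] by simp
    also have "real (Suc k) * ((\<integral>x. w (x - h k) * (u' x \<bullet> d) \<partial>lborel) - (\<integral>x. w x * (u' x \<bullet> d) \<partial>lborel))
       = (\<integral>x. real (Suc k) * (w (x - h k) * (u' x \<bullet> d) - w x * (u' x \<bullet> d)) \<partial>lborel)"
      using I0 I2 by simp
    also have "\<dots> = (\<integral>x. (u' x \<bullet> d) * (real (Suc k) * (w (x + (1 / real (Suc k)) *\<^sub>R (- e)) - w x)) \<partial>lborel)"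
      unfolding hk by (rule Bochner_Integration.integral_cong) (auto simp: algebra_simps)
    finally show ?thesis by linarith
  qed
  have "(\<lambda>k. \<integral>x. (w' x \<bullet> d) * (real (Suc k) * (u (x + h k) - u x)) \<partial>lborel)
          \<longlonglongrightarrow> (\<integral>x. (w' x \<bullet> d) * (u' x \<bullet> e) \<partial>lborel)"
    unfolding h_def
    by (rule integral_difference_quotient_tendsto[OF u, where R = R])
       (auto intro!: continuous_intros cw' simp: supp')
  moreover have "(\<lambda>k. - (\<integral>x. (u' x \<bullet> d) * (real (Suc k) * (w (x + (1 / real (Suc k)) *\<^sub>R (- e)) - w x)) \<partial>lborel))
          \<longlonglongrightarrow> - (\<integral>x. (u' x \<bullet> d) * (w' x \<bullet> (- e)) \<partial>lborel)"
    by (intro tendsto_minus integral_difference_quotient_tendsto[OF w, where R = R])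
       (auto intro!: continuous_intros cu' simp: supp)
  ultimately have "(\<integral>x. (w' x \<bullet> d) * (u' x \<bullet> e) \<partial>lborel) = - (\<integral>x. (u' x \<bullet> d) * (w' x \<bullet> (- e)) \<partial>lborel)"
    unfolding eq by (rule LIMSEQ_unique)
  then show ?thesis by (simp add: mult.commute)
qed

section \<open>Integral identities for functions of class C2\<close>

text \<open>The power \<open>J\<close> serves to bound \<open>\<eta> (|\<nabla>\<eta>| / \<eta>)\<^sup>K\<close> up to the boundary of the support, see
\<open>cutoff_ratio\<close>.\<close>

definition cutoff :: "real \<Rightarrow> nat \<Rightarrow> 'a::euclidean_space \<Rightarrow> real" where
  "cutoff R J x = max 0 (1 - (norm x)\<^sup>2 / R\<^sup>2) ^ J"

definition cutoff_grad :: "real \<Rightarrow> nat \<Rightarrow> 'a::euclidean_space \<Rightarrow> 'a" where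
  "cutoff_grad R J x = (- real J * max 0 (1 - (norm x)\<^sup>2 / R\<^sup>2) ^ (J - 1) * (2 / R\<^sup>2)) *\<^sub>R x"

lemma max_0_power_has_derivative:
  assumes "J \<ge> 2"
  shows "((\<lambda>t::real. max 0 t ^ J) has_real_derivative real J * max 0 t ^ (J - 1)) (at t)"
proof -
  obtain K where J: "J = Suc (Suc K)"
    using assms by (metis add_2_eq_Suc le_Suc_ex)
  consider "t > 0" | "t < 0" | "t = 0" by linarith
  then show ?thesis
  proof cases
    case 1
    have "((\<lambda>t::real. t ^ J) has_real_derivative real J * max 0 t ^ (J - 1)) (at t)"
      using 1 by (auto intro!: derivative_eq_intros)
    from has_field_derivative_transform_within_open[OF this open_greaterThan[of 0]] show ?thesis
      using 1 by simp
  next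
    case 2
    have "((\<lambda>t::real. 0) has_real_derivative real J * max 0 t ^ (J - 1)) (at t)"
      using 2 J by simp
    from has_field_derivative_transform_within_open[OF this open_lessThan[of 0]] show ?thesis
      using 2 J by simp
  next
    case 3
    have "((\<lambda>y::real. max 0 y ^ (J - 1)) \<longlongrightarrow> max 0 0 ^ (J - 1)) (at 0)"
      by (intro tendsto_intros)
    moreover have "max 0 y ^ (J - 1) = (max 0 y ^ J - max 0 0 ^ J) / (y - 0)" if "y \<noteq> 0" for y :: real
      using that J by (auto simp: max_def)
    ultimately have "((\<lambda>y::real. (max 0 y ^ J - max 0 0 ^ J) / (y - 0)) \<longlongrightarrow> 0) (at 0)"
      using J by (simp cong: LIM_cong)
    then show ?thesis
      using 3 J by (simp add: has_field_derivative_iff)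
  qed
qed

lemma has_cont_grad_cutoff:
  assumes "J \<ge> 2"
  shows "has_cont_grad (cutoff R J) (cutoff_grad R J)"
proof -
  have "has_cont_grad (\<lambda>x::'a. 1 - c * (x \<bullet> x)) (\<lambda>x. (- 2 * c) *\<^sub>R x)" for c
    unfolding has_cont_grad_def
    by (auto intro!: derivative_eq_intros continuous_intros simp: inner_commute fun_eq_iff)
  from this[of "1 / R\<^sup>2"]
  have 1: "has_cont_grad (\<lambda>x::'a. 1 - (norm x)\<^sup>2 / R\<^sup>2) (\<lambda>x. (- 2 / R\<^sup>2) *\<^sub>R x)"
    by (simp add: power2_norm_eq_inner)
  \<comment> \<open>The cutoff function is \<open>max 0 t ^ J\<close> composed with a quadratic polynomial.\<close>
  have "continuous_on UNIV (\<lambda>t::real. real J * max 0 t ^ (J - 1))"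
    by (intro continuous_intros)
  then show ?thesis
    unfolding cutoff_def cutoff_grad_def
    using has_cont_grad_compose[OF 1 max_0_power_has_derivative[OF assms]]
    by (simp add: continuous_on_subset mult.assoc)
qed

lemma cutoff_nonneg: "cutoff R J x \<ge> 0"
  by (simp add: cutoff_def)

lemma cutoff_eq_0:
  assumes "R > 0" "J \<ge> 1" "norm x > R"
  shows "cutoff R J x = 0"
proof -
  have "R\<^sup>2 \<le> (norm x)\<^sup>2"
    using assms by (intro power_mono) auto
  then have "1 - (norm x)\<^sup>2 / R\<^sup>2 \<le> 0"
    using assms by (simp add: divide_simps)
  then show ?thesis
    using assms by (simp add: cutoff_def max_def)
qed

lemma cutoff_grad_bound:
  fixes x :: "'a::euclidean_space"
  assumes "R > 0" "J \<ge> 2"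
  shows "norm (cutoff_grad R J x) \<le> (2 * real J / R) * max 0 (1 - (norm x)\<^sup>2 / R\<^sup>2) ^ (J - 1)"
proof (cases "norm x \<le> R")
  case True
  have "norm (cutoff_grad R J x) = real J * max 0 (1 - (norm x)\<^sup>2 / R\<^sup>2) ^ (J - 1) * (2 / R\<^sup>2) * norm x"
    by (simp add: cutoff_grad_def abs_mult)
  also have "\<dots> \<le> real J * max 0 (1 - (norm x)\<^sup>2 / R\<^sup>2) ^ (J - 1) * (2 / R\<^sup>2) * R"
    using True by (intro mult_left_mono) auto
  also have "\<dots> = (2 * real J / R) * max 0 (1 - (norm x)\<^sup>2 / R\<^sup>2) ^ (J - 1)"
    using assms by (simp add: power2_eq_square)
  finally show ?thesis .
next
  case False
  have "cutoff R (J - 1) x = 0"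
    using False assms by (intro cutoff_eq_0) auto
  then show ?thesis
    using assms by (simp add: cutoff_grad_def cutoff_def power_0_left)
qed

lemma integral_pos_of_continuous:
  fixes f :: "'a::euclidean_space \<Rightarrow> real"
  assumes "continuous_on UNIV f" "integrable lborel f" "\<And>x. f x \<ge> 0" "f x\<^sub>0 > 0"
  shows "(\<integral>x. f x \<partial>lborel) > 0"
proof -
  have "isCont f x\<^sub>0" using assms(1) by (simp add: continuous_on_eq_continuous_at)
  then obtain r where r: "r > 0" "\<And>x. dist x x\<^sub>0 < r \<Longrightarrow> dist (f x) (f x\<^sub>0) < f x\<^sub>0 / 2"
    unfolding continuous_at_eps_delta using assms(4) by (metis half_gt_zero)
  have fin: "emeasure lborel (ball x\<^sub>0 r) < \<infinity>"
    using emeasure_bounded_finite[OF bounded_ball] by simp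
  have "0 < f x\<^sub>0 / 2 * measure lborel (ball x\<^sub>0 r)"
    using assms(4) r(1) by (simp add: content_ball_pos)
  also have "\<dots> = (\<integral>x. indicator (ball x\<^sub>0 r) x * (f x\<^sub>0 / 2) \<partial>lborel)"
    by (simp add: mult.commute)
  also have "\<dots> \<le> (\<integral>x. f x \<partial>lborel)"
  proof (rule integral_mono)
    show "integrable lborel (\<lambda>x. indicator (ball x\<^sub>0 r) x * (f x\<^sub>0 / 2))"
      using fin by (intro integrable_mult_left integrable_real_indicator) auto
    show "indicator (ball x\<^sub>0 r) x * (f x\<^sub>0 / 2) \<le> f x" for x
    proof (cases "x \<in> ball x\<^sub>0 r")
      case True
      then have "dist (f x) (f x\<^sub>0) < f x\<^sub>0 / 2" by (intro r(2)) (simp add: dist_commute)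
      then have "f x\<^sub>0 / 2 \<le> f x" unfolding dist_real_def by linarith
      then show ?thesis using True by simp
    qed (use assms(3) in simp)
  qed (rule assms)
  finally show ?thesis .
qed

text \<open>Schwarz's theorem, deduced from \<open>integral_swap_derivatives\<close> by testing with a bump supported where the
difference of the two mixed derivatives is positive.\<close>

lemma hessian_symmetric:
  fixes v :: "real ^ 'n::finite \<Rightarrow> real"
  assumes v: "has_cont_grad v G" and H: "\<And>i. has_cont_grad (\<lambda>x. G x $ i) (H i)"
  shows "H i x $ j = H j x $ i"
proof -
  have False if pos: "H j x\<^sub>0 $ i - H i x\<^sub>0 $ j > 0" for i j x\<^sub>0
  proof -
    define D where "D = (\<lambda>x. H j x $ i - H i x $ j)"
    have cD: "continuous_on UNIV D"
      unfolding D_def by (intro continuous_intros has_cont_gradD[OF H])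
    then have "isCont D x\<^sub>0" by (simp add: continuous_on_eq_continuous_at)
    then obtain r where r: "r > 0" "\<And>x. dist x x\<^sub>0 < r \<Longrightarrow> dist (D x) (D x\<^sub>0) < D x\<^sub>0"
      unfolding continuous_at_eps_delta using pos D_def by metis
    define w where "w = (\<lambda>x. cutoff r 2 (x - x\<^sub>0))"
    define w' where "w' = (\<lambda>x. cutoff_grad r 2 (x - x\<^sub>0))"
    note c = has_cont_grad_cutoff[of 2 r, where 'a = "real ^ 'n", simplified]
    have w: "has_cont_grad w w'"
      unfolding has_cont_grad_def
    proof (intro conjI allI)
      fix x
      show "(w has_derivative (\<lambda>h. w' x \<bullet> h)) (at x)"
        unfolding w_def w'_def
        by (rule has_derivative_compose[OF _ has_cont_gradD(1)[OF c]]) (auto intro!: derivative_eq_intros)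
      show "continuous_on UNIV w'"
        unfolding w'_def
        by (rule continuous_on_compose2[OF has_cont_gradD(2)[OF c, of UNIV]]) (auto intro!: continuous_intros)
    qed
    have supp: "w x = 0" if "norm x > norm x\<^sub>0 + r" for x
    proof -
      have "norm (x - x\<^sub>0) > r" using that norm_triangle_ineq2[of x x\<^sub>0] by linarith
      then show ?thesis using r(1) by (simp add: w_def cutoff_eq_0)
    qed
    have 1: "(\<integral>x. (w' x \<bullet> axis i 1) * (G x \<bullet> axis j 1) \<partial>lborel) = (\<integral>x. (w' x \<bullet> axis j 1) * (G x \<bullet> axis i 1) \<partial>lborel)"
      by (rule integral_swap_derivatives[OF v w supp])
    have 2: "(\<integral>x. w x * (H k x \<bullet> axis l 1) \<partial>lborel) = - (\<integral>x. (w' x \<bullet> axis l 1) * (G x $ k) \<partial>lborel)" for k l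
      by (rule integral_by_parts[OF H w supp])
    have int: "integrable lborel (\<lambda>x. w x * H k x $ l)" for k l
      by (rule integrable_compact_support[where R = "norm x\<^sub>0 + r"])
         (auto simp: supp intro!: continuous_intros has_cont_gradD[OF H] has_cont_gradD[OF w])
    have "(\<integral>x. w x * D x \<partial>lborel) = (\<integral>x. w x * H j x $ i - w x * H i x $ j \<partial>lborel)"
      by (simp add: D_def right_diff_distrib)
    also have "\<dots> = 0"
      using 1 2[of i j] 2[of j i] int by (simp add: inner_axis)
    finally have "(\<integral>x. w x * D x \<partial>lborel) = 0" .
    moreover have "(\<integral>x. w x * D x \<partial>lborel) > 0"
    proof (rule integral_pos_of_continuous)
      show "continuous_on UNIV (\<lambda>x. w x * D x)"
        by (intro continuous_intros cD has_cont_gradD[OF w])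
      then show "integrable lborel (\<lambda>x. w x * D x)"
        by (rule integrable_compact_support[where R = "norm x\<^sub>0 + r"]) (simp add: supp)
      show "w x\<^sub>0 * D x\<^sub>0 > 0"
        using pos by (simp add: w_def cutoff_def D_def)
      fix x
      show "w x * D x \<ge> 0"
      proof (cases "dist x x\<^sub>0 < r")
        case True
        then have "D x > 0" using r(2)[of x] by (simp add: dist_real_def)
        then show ?thesis by (simp add: w_def cutoff_nonneg)
      next
        case False
        then have "w x = 0"
          using r(1) power_mono[of r "norm (x - x\<^sub>0)" 2]
          by (simp add: w_def cutoff_def dist_norm max_def divide_simps)
        then show ?thesis by simp
      qed
    qed
    ultimately show False by simp
  qed
  from this[of j x i] this[of i x j] show ?thesis
    by (metis diff_gt_0_iff_gt linorder_neqE_linordered_idom)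
qed

lemma weak_laplacian:
  fixes v :: "real ^ 'n::finite \<Rightarrow> real"
  assumes v: "has_cont_grad v G" and H: "\<And>i. has_cont_grad (\<lambda>x. G x $ i) (H i)"
    and w: "has_cont_grad w w'" and supp: "\<And>x. norm x > R \<Longrightarrow> w x = 0"
  shows "(\<integral>x. w x * (\<Sum>i\<in>UNIV. H i x $ i) + w' x \<bullet> G x \<partial>lborel) = 0"
proof -
  note supp' = grad_eq_0_outside_support[OF w supp]
  have cG: "continuous_on UNIV (\<lambda>x. G x $ i)" for i
    by (rule has_cont_gradD[OF H])
  have int: "integrable lborel (\<lambda>x. w x * H i x $ i)" "integrable lborel (\<lambda>x. w' x $ i * G x $ i)" for i
    by (rule integrable_compact_support[where R = R];
        auto simp: supp supp' intro!: continuous_intros cG has_cont_gradD[OF H] has_cont_gradD[OF w])+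
  have "(\<integral>x. w x * (H i x \<bullet> axis i 1) \<partial>lborel) = - (\<integral>x. (w' x \<bullet> axis i 1) * (G x $ i) \<partial>lborel)" for i
    by (rule integral_by_parts[OF H w supp])
  then have "(\<Sum>i\<in>UNIV. (\<integral>x. w x * H i x $ i \<partial>lborel) + (\<integral>x. w' x $ i * G x $ i \<partial>lborel)) = 0"
    by (simp add: inner_axis)
  also have "(\<Sum>i\<in>UNIV. (\<integral>x. w x * H i x $ i \<partial>lborel) + (\<integral>x. w' x $ i * G x $ i \<partial>lborel))
     = (\<integral>x. (\<Sum>i\<in>UNIV. w x * H i x $ i + w' x $ i * G x $ i) \<partial>lborel)"
    using int by simp
  also have "(\<lambda>x. \<Sum>i\<in>UNIV. w x * H i x $ i + w' x $ i * G x $ i)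
     = (\<lambda>x. w x * (\<Sum>i\<in>UNIV. H i x $ i) + w' x \<bullet> G x)"
    by (simp add: fun_eq_iff sum.distrib sum_distrib_left inner_vec_def)
  finally show ?thesis .
qed

text \<open>Summing \<open>integral_swap_derivatives\<close> over all \<open>i\<close> and \<open>j\<close>, with \<open>u = \<partial>\<^sub>i v\<close> and \<open>w \<partial>\<^sub>j v\<close> as the compactly
supported factor, gives the identity that one would otherwise obtain from the divergence of
\<open>D\<^sup>2v \<nabla>v - \<Delta>v \<nabla>v\<close>.\<close>

lemma weak_bochner:
  fixes v :: "real ^ 'n::finite \<Rightarrow> real"
  assumes v: "has_cont_grad v G" and H: "\<And>i. has_cont_grad (\<lambda>x. G x $ i) (H i)"
    and w: "has_cont_grad w w'" and supp: "\<And>x. norm x > R \<Longrightarrow> w x = 0"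
  shows "(\<integral>x. w x * ((\<Sum>i\<in>UNIV. H i x \<bullet> H i x) - (\<Sum>i\<in>UNIV. H i x $ i)\<^sup>2)
            + w' x \<bullet> (\<chi> i. H i x \<bullet> G x) - (w' x \<bullet> G x) * (\<Sum>i\<in>UNIV. H i x $ i) \<partial>lborel) = 0"
proof -
  note supp' = grad_eq_0_outside_support[OF w supp]
  have sym: "H i x $ j = H j x $ i" for i j x
    by (rule hessian_symmetric[OF v H])
  have cG: "continuous_on UNIV (\<lambda>x. G x $ i)" for i
    by (rule has_cont_gradD[OF H])
  define P where "P = (\<lambda>j x. w x *\<^sub>R H j x + G x $ j *\<^sub>R w' x)"
  have P: "has_cont_grad (\<lambda>x. w x * G x $ j) (P j)" for j
    unfolding P_def by (rule has_cont_grad_mult[OF w H])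
  have Psupp: "P j x = 0" if "norm x > R" for j x
    using that by (simp add: P_def supp supp')
  have int: "integrable lborel (\<lambda>x. P j x $ k * H i x $ l)" for i j k l
    by (rule integrable_compact_support[where R = R])
       (auto simp: Psupp intro!: continuous_intros has_cont_gradD[OF H] has_cont_gradD[OF P])
  have "(\<integral>x. (P j x \<bullet> axis i 1) * (H i x \<bullet> axis j 1) \<partial>lborel) = (\<integral>x. (P j x \<bullet> axis j 1) * (H i x \<bullet> axis i 1) \<partial>lborel)" for i j
    by (rule integral_swap_derivatives[OF H P, where R = R]) (simp add: supp)
  then have eq: "(\<integral>x. P j x $ i * H i x $ j \<partial>lborel) = (\<integral>x. P j x $ j * H i x $ i \<partial>lborel)" for i j
    by (simp add: inner_axis)
  then have eq0: "(\<integral>x. P j x $ i * H i x $ j \<partial>lborel) - (\<integral>x. P j x $ j * H i x $ i \<partial>lborel) = 0" for i j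
    by (rule iffD2[OF right_minus_eq])
  have "(\<Sum>i\<in>UNIV. \<Sum>j\<in>UNIV. (\<integral>x. P j x $ i * H i x $ j \<partial>lborel) - (\<integral>x. P j x $ j * H i x $ i \<partial>lborel)) = 0"
    by (intro sum.neutral ballI) (rule eq0)
  also have "(\<Sum>i\<in>UNIV. \<Sum>j\<in>UNIV. (\<integral>x. P j x $ i * H i x $ j \<partial>lborel) - (\<integral>x. P j x $ j * H i x $ i \<partial>lborel))
     = (\<integral>x. (\<Sum>i\<in>UNIV. \<Sum>j\<in>UNIV. P j x $ i * H i x $ j - P j x $ j * H i x $ i) \<partial>lborel)"
    using int by simp
  also have "(\<lambda>x. \<Sum>i\<in>UNIV. \<Sum>j\<in>UNIV. P j x $ i * H i x $ j - P j x $ j * H i x $ i)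
     = (\<lambda>x. w x * ((\<Sum>i\<in>UNIV. H i x \<bullet> H i x) - (\<Sum>i\<in>UNIV. H i x $ i)\<^sup>2)
            + w' x \<bullet> (\<chi> i. H i x \<bullet> G x) - (w' x \<bullet> G x) * (\<Sum>i\<in>UNIV. H i x $ i))"
  proof
    fix x
    have 1: "(\<Sum>i\<in>UNIV. \<Sum>j\<in>UNIV. P j x $ i * H i x $ j)
        = w x * (\<Sum>i\<in>UNIV. H i x \<bullet> H i x) + w' x \<bullet> (\<chi> i. H i x \<bullet> G x)"
      by (simp add: P_def inner_vec_def sum.distrib sum_distrib_left algebra_simps sym[of _ x])
    have 2: "(\<Sum>i\<in>UNIV. \<Sum>j\<in>UNIV. P j x $ j * H i x $ i)
        = w x * (\<Sum>i\<in>UNIV. H i x $ i)\<^sup>2 + (w' x \<bullet> G x) * (\<Sum>i\<in>UNIV. H i x $ i)"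
    proof -
      have "(\<Sum>i\<in>UNIV. \<Sum>j\<in>UNIV. P j x $ j * H i x $ i) = (\<Sum>j\<in>UNIV. P j x $ j) * (\<Sum>i\<in>UNIV. H i x $ i)"
        by (simp add: sum_product sum.swap[of "\<lambda>i j. P j x $ j * H i x $ i"])
      also have "(\<Sum>j\<in>UNIV. P j x $ j) = w x * (\<Sum>i\<in>UNIV. H i x $ i) + w' x \<bullet> G x"
        by (simp add: P_def inner_vec_def sum.distrib sum_distrib_left mult.commute)
      finally show ?thesis by (simp add: algebra_simps power2_eq_square)
    qed
    show "(\<Sum>i\<in>UNIV. \<Sum>j\<in>UNIV. P j x $ i * H i x $ j - P j x $ j * H i x $ i)
       = w x * ((\<Sum>i\<in>UNIV. H i x \<bullet> H i x) - (\<Sum>i\<in>UNIV. H i x $ i)\<^sup>2)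
            + w' x \<bullet> (\<chi> i. H i x \<bullet> G x) - (w' x \<bullet> G x) * (\<Sum>i\<in>UNIV. H i x $ i)"
      by (simp only: sum_subtractf 1 2) (simp add: algebra_simps)
  qed
  finally show ?thesis .
qed

section \<open>The strong minimum principle\<close>

lemma local_min_second_derivative_nonneg:
  fixes f f' :: "real \<Rightarrow> real"
  assumes f: "\<And>t. (f has_real_derivative f' t) (at t)"
    and L: "(f' has_real_derivative L) (at 0)"
    and "r > 0" and min: "\<And>t. \<bar>t\<bar> < r \<Longrightarrow> f 0 \<le> f t"
  shows "L \<ge> 0"
proof (rule ccontr)
  assume "\<not> L \<ge> 0"
  then obtain d where d: "d > 0" "\<And>h. 0 < h \<Longrightarrow> h < d \<Longrightarrow> f' (0 + h) < f' 0"
    using DERIV_neg_dec_right[OF L] by auto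
  have "f' 0 = 0"
    using DERIV_local_min[OF f \<open>r > 0\<close>] min by simp
  define t where "t = min d r / 2"
  have t: "0 < t" "t < d" "t < r" using d(1) \<open>r > 0\<close> by (auto simp: t_def)
  obtain c where c: "0 < c" "c < t" "f t - f 0 = (t - 0) * f' c"
    using MVT2[OF t(1)] f by blast
  have "f' c < 0" using d(2)[of c] c t \<open>f' 0 = 0\<close> by simp
  then have "f t < f 0" using mult_pos_neg[of t "f' c"] c t by simp
  with min[of t] t show False by simp
qed

lemma has_cont_grad_along_line:
  assumes "has_cont_grad f g"
  shows "((\<lambda>t. f (x + t *\<^sub>R e)) has_real_derivative g (x + t *\<^sub>R e) \<bullet> e) (at t)"
proof -
  have "((\<lambda>t. f (x + t *\<^sub>R e)) has_derivative (\<lambda>s. g (x + t *\<^sub>R e) \<bullet> (s *\<^sub>R e))) (at t)"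
    by (rule has_derivative_compose[OF _ has_cont_gradD(1)[OF assms]]) (auto intro!: derivative_eq_intros)
  then show ?thesis
    by (rule has_derivative_imp_has_field_derivative) simp
qed

lemma local_min_laplacian_nonneg:
  fixes u :: "real ^ 'n::finite \<Rightarrow> real"
  assumes u: "has_cont_grad u U" and W: "\<And>i. has_cont_grad (\<lambda>x. U x $ i) (W i)"
    and "open S" "y \<in> S" and min: "\<And>x. x \<in> S \<Longrightarrow> u y \<le> u x"
  shows "(\<Sum>i\<in>UNIV. W i y $ i) \<ge> 0"
proof (rule sum_nonneg)
  fix i
  obtain r where r: "r > 0" "ball y r \<subseteq> S"
    using \<open>open S\<close> \<open>y \<in> S\<close> openE by blast
  have *: "((\<lambda>t. u (y + t *\<^sub>R axis i 1)) has_real_derivative U (y + t *\<^sub>R axis i 1) $ i) (at t)" for t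
    using has_cont_grad_along_line[OF u, of y "axis i 1"] by (simp add: inner_axis)
  show "W i y $ i \<ge> 0"
  proof (rule local_min_second_derivative_nonneg[OF * _ r(1)])
    show "((\<lambda>t. U (y + t *\<^sub>R axis i 1) $ i) has_real_derivative W i y $ i) (at 0)"
      using has_cont_grad_along_line[OF W[of i], of y "axis i 1" 0] by (simp add: inner_axis)
    fix t :: real assume "\<bar>t\<bar> < r"
    then have "y + t *\<^sub>R axis i 1 \<in> ball y r"
      by (simp add: dist_norm norm_axis_1)
    then show "u (y + 0 *\<^sub>R axis i 1) \<le> u (y + t *\<^sub>R axis i 1)"
      using min r by auto
  qed
qed

text \<open>The Gaussian is the barrier in the proof of the strong minimum principle.\<close>

lemma gaussian_has_cont_grad:
  fixes c :: "real ^ 'n::finite" and \<alpha> :: real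
  defines "w \<equiv> \<lambda>x. exp (- \<alpha> * ((x - c) \<bullet> (x - c)))"
  shows "has_cont_grad w (\<lambda>x. (- 2 * \<alpha> * w x) *\<^sub>R (x - c))"
    and "has_cont_grad (\<lambda>x. ((- 2 * \<alpha> * w x) *\<^sub>R (x - c)) $ i)
           (\<lambda>x. (- 2 * \<alpha> * w x) *\<^sub>R (axis i 1 - (2 * \<alpha> * (x - c) $ i) *\<^sub>R (x - c)))"
proof -
  show w: "has_cont_grad w (\<lambda>x. (- 2 * \<alpha> * w x) *\<^sub>R (x - c))"
    unfolding has_cont_grad_def w_def
    by (auto intro!: derivative_eq_intros continuous_intros
        simp: inner_commute fun_eq_iff algebra_simps)
  have "has_cont_grad (\<lambda>x. - 2 * \<alpha> * ((x - c) $ i)) (\<lambda>x. (- 2 * \<alpha>) *\<^sub>R axis i 1)"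
    unfolding has_cont_grad_def
  proof (intro conjI allI)
    have "((\<lambda>x. (- 2 * \<alpha>) *\<^sub>R axis i 1 \<bullet> (x - c)) has_derivative (\<lambda>h. (- 2 * \<alpha>) *\<^sub>R axis i 1 \<bullet> h)) (at x)" for x
      by (auto intro!: derivative_eq_intros)
    then show "((\<lambda>x. - 2 * \<alpha> * ((x - c) $ i)) has_derivative (\<lambda>h. ((- 2 * \<alpha>) *\<^sub>R axis i 1) \<bullet> h)) (at x)" for x
      by (simp add: inner_axis')
  qed simp
  from has_cont_grad_mult[OF this w]
  show "has_cont_grad (\<lambda>x. ((- 2 * \<alpha> * w x) *\<^sub>R (x - c)) $ i)
           (\<lambda>x. (- 2 * \<alpha> * w x) *\<^sub>R (axis i 1 - (2 * \<alpha> * (x - c) $ i) *\<^sub>R (x - c)))"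
    by (simp add: algebra_simps)
qed

text \<open>Hopf's argument. Around a point \<open>c\<close> with \<open>v c > 0\<close> take the largest ball on which \<open>v\<close> is positive; its
boundary contains a zero \<open>z\<close> of \<open>v\<close>. On an annulus inside this ball \<open>v\<close> stays above a small multiple
of a strictly subharmonic barrier which also vanishes at \<open>z\<close>, so \<open>v\<close> grows at least linearly from \<open>z\<close>
towards \<open>c\<close>. But \<open>z\<close> is a minimum of \<open>v\<close>, so the gradient of \<open>v\<close> vanishes there.\<close>

lemma strong_minimum_principle:
  fixes v :: "real ^ 'n::finite \<Rightarrow> real"
  assumes v: "has_cont_grad v G" and H: "\<And>i. has_cont_grad (\<lambda>x. G x $ i) (H i)"
    and super: "\<And>x. (\<Sum>i\<in>UNIV. H i x $ i) \<le> 0"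
    and nonneg: "\<And>x. v x \<ge> 0" and "v z\<^sub>0 = 0"
  shows "v c = 0"
proof (rule ccontr)
  assume "v c \<noteq> 0"
  define Z where "Z = {x. v x = 0}"
  have cv: "continuous_on S v" for S by (rule has_cont_gradD[OF v])
  have "closed Z"
    unfolding Z_def by (rule closed_Collect_eq) (auto intro: cv)
  moreover have "Z \<noteq> {}" using \<open>v z\<^sub>0 = 0\<close> by (auto simp: Z_def)
  ultimately obtain z where z: "z \<in> Z" "\<And>y. y \<in> Z \<Longrightarrow> dist c z \<le> dist c y"
    using distance_attains_inf by blast
  define r where "r = dist c z"
  have "r > 0" using z(1) \<open>v c \<noteq> 0\<close> by (auto simp: r_def Z_def)
  have inside: "v x > 0" if "dist c x < r" for x
    using z(2)[of x] that nonneg[of x] by (force simp: r_def Z_def)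
  \<comment> \<open>The Laplacian of \<open>exp (- \<alpha> |x - c|\<^sup>2)\<close> is positive where \<open>2 \<alpha> |x - c|\<^sup>2 > n\<close>; this \<open>\<alpha>\<close> makes
    it so on the whole annulus \<open>r / 2 < |x - c| < r\<close>.\<close>
  define n where "n = real CARD('n)"
  define \<alpha> where "\<alpha> = 4 * n / r\<^sup>2"
  have "n > 0" by (simp add: n_def)
  have "\<alpha> > 0" using \<open>r > 0\<close> \<open>n > 0\<close> by (simp add: \<alpha>_def)
  define w where "w = (\<lambda>x. exp (- \<alpha> * ((x - c) \<bullet> (x - c))))"
  have gauss: "has_cont_grad w (\<lambda>x. (- 2 * \<alpha> * w x) *\<^sub>R (x - c))"
    "has_cont_grad (\<lambda>x. ((- 2 * \<alpha> * w x) *\<^sub>R (x - c)) $ i)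
       (\<lambda>x. (- 2 * \<alpha> * w x) *\<^sub>R (axis i 1 - (2 * \<alpha> * (x - c) $ i) *\<^sub>R (x - c)))" for i
    unfolding w_def by (rule gaussian_has_cont_grad)+
  have w_bounds: "0 < w x" "w x \<le> 1" for x
    using \<open>\<alpha> > 0\<close> by (auto simp: w_def)
  have "compact (sphere c (r / 2))" "sphere c (r / 2) \<noteq> {}"
    using \<open>r > 0\<close> by simp_all
  from continuous_attains_inf[OF this cv] obtain y\<^sub>0 where
    y\<^sub>0: "y\<^sub>0 \<in> sphere c (r / 2)" "\<And>y. y \<in> sphere c (r / 2) \<Longrightarrow> v y\<^sub>0 \<le> v y"
    by blast
  define \<epsilon> where "\<epsilon> = v y\<^sub>0"
  have "\<epsilon> > 0" unfolding \<epsilon>_def using y\<^sub>0(1) \<open>r > 0\<close> by (intro inside) simp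
  define w\<^sub>r where "w\<^sub>r = exp (- \<alpha> * r\<^sup>2)"
  define u where "u = (\<lambda>x. v x + (- \<epsilon>) * (w x + (- w\<^sub>r)))"
  define U where "U = (\<lambda>x. G x + (- \<epsilon>) *\<^sub>R ((- 2 * \<alpha> * w x) *\<^sub>R (x - c)))"
  define W where "W = (\<lambda>i x. H i x + (- \<epsilon>) *\<^sub>R ((- 2 * \<alpha> * w x) *\<^sub>R (axis i 1 - (2 * \<alpha> * (x - c) $ i) *\<^sub>R (x - c))))"
  have u: "has_cont_grad u U"
    using has_cont_grad_add[OF v has_cont_grad_mult[OF has_cont_grad_const
          has_cont_grad_add[OF gauss(1) has_cont_grad_const]], of "- \<epsilon>" "- w\<^sub>r"]
    by (simp add: u_def U_def)
  have W: "has_cont_grad (\<lambda>x. U x $ i) (W i)" for i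
    using has_cont_grad_add[OF H[of i] has_cont_grad_mult[OF has_cont_grad_const gauss(2)[of i]], of "- \<epsilon>"]
    by (simp add: U_def W_def mult.assoc)
  have laplacian_neg: "(\<Sum>i\<in>UNIV. W i x $ i) < 0" if "dist c x > r / 2" for x
  proof -
    have "(r / 2)\<^sup>2 < (dist c x)\<^sup>2"
      using that \<open>r > 0\<close> by (intro power_strict_mono) auto
    then have "\<alpha> * (r / 2)\<^sup>2 < \<alpha> * ((x - c) \<bullet> (x - c))"
      using \<open>\<alpha> > 0\<close> by (simp add: dist_norm norm_minus_commute flip: power2_norm_eq_inner)
    moreover have "\<alpha> * (r / 2)\<^sup>2 = n"
      using \<open>r > 0\<close> by (simp add: \<alpha>_def power2_eq_square)
    ultimately have "n - 2 * \<alpha> * ((x - c) \<bullet> (x - c)) < 0" using \<open>n > 0\<close> by linarith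
    moreover have "2 * \<epsilon> * \<alpha> * w x > 0" using \<open>\<epsilon> > 0\<close> \<open>\<alpha> > 0\<close> w_bounds by simp
    ultimately have "2 * \<epsilon> * \<alpha> * w x * (n - 2 * \<alpha> * ((x - c) \<bullet> (x - c))) < 0"
      by (simp add: mult_pos_neg)
    moreover have "(\<Sum>i\<in>UNIV. W i x $ i) = (\<Sum>i\<in>UNIV. H i x $ i)
        + 2 * \<epsilon> * \<alpha> * w x * (n - 2 * \<alpha> * ((x - c) \<bullet> (x - c)))"
    proof -
      have "(\<Sum>i\<in>UNIV. W i x $ i) = (\<Sum>i\<in>UNIV. H i x $ i + 2 * \<epsilon> * \<alpha> * w x * (1 - 2 * \<alpha> * ((x - c) $ i * (x - c) $ i)))"
        by (simp add: W_def algebra_simps axis_def)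
      also have "\<dots> = (\<Sum>i\<in>UNIV. H i x $ i) + 2 * \<epsilon> * \<alpha> * w x * (\<Sum>i\<in>UNIV. 1 - 2 * \<alpha> * ((x - c) $ i * (x - c) $ i))"
        by (simp only: sum.distrib sum_distrib_left)
      also have "(\<Sum>i\<in>UNIV. 1 - 2 * \<alpha> * ((x - c) $ i * (x - c) $ i)) = n - 2 * \<alpha> * ((x - c) \<bullet> (x - c))"
        by (simp only: sum_subtractf n_def inner_vec_def inner_real_def sum_distrib_left[symmetric]) simp
      finally show ?thesis .
    qed
    ultimately show ?thesis using super[of x] by linarith
  qed
  define K where "K = {x. r / 2 \<le> dist c x \<and> dist c x \<le> r}"
  have K_eq: "K = cball c r - ball c (r / 2)" by (auto simp: K_def)
  have "compact K" unfolding K_eq by (rule compact_diff) auto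
  moreover have "z \<in> K" using \<open>r > 0\<close> by (simp add: K_def r_def)
  ultimately obtain y where y: "y \<in> K" "\<And>x. x \<in> K \<Longrightarrow> u y \<le> u x"
    using continuous_attains_inf[of K u] has_cont_gradD(3)[OF u] by blast
  have w_r: "w x = w\<^sub>r" if "dist c x = r" for x
    using that by (simp add: w_def w\<^sub>r_def dist_norm norm_minus_commute flip: power2_norm_eq_inner)
  have u_nonneg: "u x \<ge> 0" if "x \<in> K" for x
  proof -
    have "u y \<ge> 0"
    proof (rule ccontr)
      assume neg: "\<not> u y \<ge> 0"
      consider "dist c y = r" | "dist c y = r / 2" | "r / 2 < dist c y" "dist c y < r"
        using y(1) by (force simp: K_def)
      then show False
      proof cases
        case 1
        then show False using neg nonneg[of y] w_r by (simp add: u_def)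
      next
        case 2
        then have "v y \<ge> \<epsilon>" using y\<^sub>0(2)[of y] by (simp add: \<epsilon>_def)
        moreover have "w\<^sub>r > 0" by (simp add: w\<^sub>r_def)
        then have "\<epsilon> * (w y - w\<^sub>r) \<le> \<epsilon> * 1"
          using \<open>\<epsilon> > 0\<close> w_bounds(2)[of y] by (intro mult_left_mono) linarith+
        ultimately show False using neg by (simp add: u_def algebra_simps)
      next
        case 3
        have "open {x. r / 2 < dist c x \<and> dist c x < r}"
          by (intro open_Collect_conj open_Collect_less continuous_intros)
        then have "(\<Sum>i\<in>UNIV. W i y $ i) \<ge> 0"
          using 3 by (intro local_min_laplacian_nonneg[OF u W]) (auto intro: y(2) simp: K_def)
        with laplacian_neg[of y] 3 show False by simp
      qed
    qed
    with y(2)[OF that] show ?thesis by simp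
  qed
  \<comment> \<open>At \<open>z\<close> the gradient of \<open>v\<close> vanishes whereas the barrier has positive slope towards \<open>c\<close>, so
    \<open>u\<close> would become negative inside the annulus.\<close>
  have "G z = 0"
  proof -
    have "((\<lambda>x. v x) has_derivative (\<lambda>h. G z \<bullet> h)) (at z)" by (rule has_cont_gradD[OF v])
    moreover have "\<forall>x. v z \<le> v x" using z(1) nonneg by (simp add: Z_def)
    ultimately have "(\<lambda>h. G z \<bullet> h) = (\<lambda>h. 0)"
      using has_derivative_local_min[of v "\<lambda>h. G z \<bullet> h" z] by simp
    then have "G z \<bullet> G z = 0" by metis
    then show ?thesis by simp
  qed
  have zz: "(z - c) \<bullet> (z - c) = r\<^sup>2"
    by (simp add: r_def dist_norm norm_minus_commute flip: power2_norm_eq_inner)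
  have "((\<lambda>t. u (z + t *\<^sub>R (c - z))) has_real_derivative U z \<bullet> (c - z)) (at 0)"
    using has_cont_grad_along_line[OF u, of z "c - z" 0] by simp
  moreover have "U z \<bullet> (c - z) = - (2 * \<epsilon> * \<alpha> * w z * r\<^sup>2)"
  proof -
    have "(c - z) = - (z - c)" by simp
    then have "U z \<bullet> (c - z) = - (2 * \<epsilon> * \<alpha> * w z * ((z - c) \<bullet> (z - c)))"
      by (simp only: U_def \<open>G z = 0\<close> inner_minus_right) simp
    then show ?thesis by (simp only: zz)
  qed
  moreover have "- (2 * \<epsilon> * \<alpha> * w z * r\<^sup>2) < 0"
    using \<open>\<epsilon> > 0\<close> \<open>\<alpha> > 0\<close> w_bounds \<open>r > 0\<close> by simp
  ultimately obtain d where d: "d > 0" "\<And>h. 0 < h \<Longrightarrow> h < d \<Longrightarrow> u (z + (0 + h) *\<^sub>R (c - z)) < u (z + 0 *\<^sub>R (c - z))"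
    using DERIV_neg_dec_right by metis
  define h where "h = min (d / 2) (1 / 2)"
  have h: "0 < h" "h < d" "h \<le> 1 / 2" using d(1) by (auto simp: h_def)
  have "dist c (z + h *\<^sub>R (c - z)) = (1 - h) * r"
  proof -
    have "c - (z + h *\<^sub>R (c - z)) = (1 - h) *\<^sub>R (c - z)" by (simp add: algebra_simps)
    then show ?thesis using h by (simp add: dist_norm r_def)
  qed
  moreover have "0 \<le> h * r" "h * r \<le> 1 / 2 * r"
    using h \<open>r > 0\<close> by (intro mult_nonneg_nonneg mult_right_mono; simp)+
  ultimately have "z + h *\<^sub>R (c - z) \<in> K"
    unfolding K_def mem_Collect_eq left_diff_distrib by linarith
  then have "u (z + h *\<^sub>R (c - z)) \<ge> 0" by (rule u_nonneg)
  moreover have "u z = 0"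
    using z(1) w_r[of z] by (simp add: u_def Z_def r_def)
  ultimately show False using d(2)[of h] h by simp
qed

section \<open>The reaction term as a function of one variable\<close>

text \<open>\<open>n\<close> stands for the dimension, and \<open>crit\<close> is the bound by the critical exponent with the denominator
cleared.\<close>

locale exponents =
  fixes n p M :: real
  assumes n: "n \<ge> 3" and p: "p > 1" and crit: "p * (n - 2) \<le> n + 2" and M: "M > 0"
begin

text \<open>In the variable \<open>x = |\<nabla>v|\<^sup>2 / v\<^sup>p\<^sup>+\<^sup>1\<close> the equation is \<open>\<Delta>v = - v\<^sup>p F(x)\<close>. The weights of the test functions
are \<open>v\<^sup>\<kappa>\<^sup>-\<^sup>p\<close> and \<open>v\<^sup>\<kappa>\<close>; this \<open>\<kappa>\<close> makes the terms of mixed type \<open>x F(x)\<close> in \<open>reaction\<close> below cancel except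
for those that belong to the product \<open>(F(x) - \<kappa> x) (F(x\<^sub>1) - F(x))\<close>.\<close>

definition "s = p / (p + 1)"
definition "\<kappa> = p * n / (n + 2)"
definition "m = (n - 1) / n"
definition F :: "real \<Rightarrow> real" where "F x = 1 + M * x powr s"

lemma s_bounds: "0 < s" "s < 1"
  using p by (auto simp: s_def)

lemma m_bounds: "m \<ge> 2 / 3" "m < 1" "m > 0"
  using n by (auto simp: m_def field_simps)

lemma \<kappa>_bounds: "\<kappa> > 0" "2 * \<kappa> \<le> p + 1"
proof -
  show "\<kappa> > 0" using n p by (simp add: \<kappa>_def)
  show "2 * \<kappa> \<le> p + 1" using crit n by (simp add: \<kappa>_def field_simps)
qed

lemma F_mono: "0 \<le> x \<Longrightarrow> x \<le> y \<Longrightarrow> F x \<le> F y"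
  using M s_bounds by (simp add: F_def powr_mono2)

lemma F_ge_1: "F x \<ge> 1"
  using M by (simp add: F_def)

lemma F_continuous: "continuous_on {0..} F"
  unfolding F_def using s_bounds by (intro continuous_intros continuous_on_powr') auto

lemma F_quotient_antimono:
  assumes "0 < x" "x \<le> y"
  shows "F y / y \<le> F x / x"
proof -
  have "F x / x = 1 / x + M * x powr (s - 1)" if "x > 0" for x
    using that by (simp add: F_def add_divide_distrib powr_diff)
  moreover have "y powr (s - 1) \<le> x powr (s - 1)"
    using assms s_bounds by (intro powr_mono2') auto
  ultimately show ?thesis
    using assms M by (auto intro!: add_mono mult_left_mono divide_left_mono)
qed

text \<open>The increments of \<open>F\<close> dominate the decrements of \<open>1 / (1 + x)\<close> up to a factor. Hence a small multiple of the
latter may be added to \<open>h\<close> without changing the sign of the factor \<open>F(x\<^sub>1) - F(x)\<close>.\<close>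

lemma F_gap:
  assumes "0 \<le> x" "x \<le> y"
  shows "M * s * (1 / (1 + x) - 1 / (1 + y)) \<le> F y - F x"
proof (cases "x = y")
  case False
  then have xy: "x < y" "y > 0" using assms by auto
  have "\<exists>z. x < z \<and> z < y \<and> y powr s - x powr s = (y - x) * (s * z powr (s - 1))"
  proof -
    have "\<exists>l z. x < z \<and> z < y \<and> DERIV (\<lambda>t. t powr s) z :> l \<and> y powr s - x powr s = (y - x) * l"
    proof (rule MVT[OF xy(1)])
      show "continuous_on {x..y} (\<lambda>t. t powr s)"
        using assms s_bounds by (intro continuous_on_powr' continuous_intros) auto
      show "(\<lambda>t. t powr s) differentiable (at z)" if "x < z" "z < y" for z
        using that assms has_real_derivative_powr[of z s] by (auto simp: real_differentiable_def)
    qed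
    then obtain l z where *: "x < z" "z < y" "DERIV (\<lambda>t. t powr s) z :> l" "y powr s - x powr s = (y - x) * l"
      by blast
    have "l = s * z powr (s - 1)"
      using DERIV_unique[OF *(3) has_real_derivative_powr[of z s]] * assms by simp
    with * show ?thesis by blast
  qed
  then obtain z where z: "x < z" "z < y" "y powr s - x powr s = (y - x) * (s * z powr (s - 1))"
    by blast
  have "1 / (1 + y) \<le> z powr (s - 1)"
  proof -
    have "1 / (1 + y) \<le> (1 + y) powr (s - 1)"
      using powr_mono[of "-1" "s - 1" "1 + y"] assms xy s_bounds by (simp add: powr_minus_divide)
    also have "\<dots> \<le> z powr (s - 1)"
      using z assms s_bounds by (intro powr_mono2') auto
    finally show ?thesis .
  qed
  have "1 / (1 + x) - 1 / (1 + y) = (y - x) * (1 / (1 + x)) * (1 / (1 + y))"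
    using assms xy by (simp add: field_simps)
  also have "\<dots> \<le> (y - x) * 1 * z powr (s - 1)"
    using assms xy \<open>1 / (1 + y) \<le> z powr (s - 1)\<close>
    by (intro mult_mono) (auto simp: divide_simps)
  finally have "M * s * (1 / (1 + x) - 1 / (1 + y)) \<le> M * s * ((y - x) * z powr (s - 1))"
    using M s_bounds by (intro mult_left_mono) auto
  also have "\<dots> = F y - F x"
  proof -
    have "F y - F x = M * (y powr s - x powr s)" by (simp add: F_def algebra_simps)
    then show ?thesis unfolding z(3) by simp
  qed
  finally show ?thesis .
qed simp

lemma F_at_top: "filterlim F at_top at_top"
  unfolding filterlim_at_top
proof
  fix Z
  show "\<forall>\<^sub>F x in at_top. Z \<le> F x"
    using eventually_ge_at_top[of "(\<bar>Z\<bar> / M) powr (1 / s)"]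
  proof eventually_elim
    case (elim x)
    have "((\<bar>Z\<bar> / M) powr (1 / s)) powr s \<le> x powr s"
      using elim s_bounds by (intro powr_mono2) auto
    moreover have "((\<bar>Z\<bar> / M) powr (1 / s)) powr s = \<bar>Z\<bar> / M"
      using s_bounds M by (simp add: powr_powr)
    ultimately show "Z \<le> F x"
      using M by (simp add: F_def divide_le_eq mult.commute)
  qed
qed

lemma F_sublinear: "((\<lambda>x. F x / x) \<longlongrightarrow> 0) at_top"
proof -
  have "((\<lambda>x. 1 / x + M * x powr (s - 1)) \<longlongrightarrow> 0 + M * 0) at_top"
    using s_bounds by (intro tendsto_intros tendsto_neg_powr filterlim_ident tendsto_divide_0[OF tendsto_const]) 
      (auto intro: filterlim_at_top_imp_at_infinity filterlim_ident)
  moreover have "eventually (\<lambda>x. 1 / x + M * x powr (s - 1) = F x / x) at_top"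
    using eventually_gt_at_top[of 0]
    by eventually_elim (simp add: F_def add_divide_distrib powr_diff)
  ultimately show ?thesis by (simp add: tendsto_cong)
qed

lemma root_exists: "\<exists>x>0. F x = \<kappa> * x"
proof -
  have "eventually (\<lambda>x. x > 0 \<and> F x / x < \<kappa>) at_top"
    using F_sublinear \<kappa>_bounds by (intro eventually_conj eventually_gt_at_top order_tendstoD(2)) 
  then obtain b where b: "b > 0" "F b / b < \<kappa>"
    by (auto simp: eventually_at_top_linorder)
  have "continuous_on {0..b} (\<lambda>x. \<kappa> * x - F x)"
    by (intro continuous_intros continuous_on_subset[OF F_continuous]) auto
  moreover have "\<kappa> * b - F b \<ge> 0" using b by (simp add: field_simps)
  moreover have "\<kappa> * 0 - F 0 \<le> 0" using F_ge_1[of 0] by simp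
  ultimately obtain x where x: "0 \<le> x" "x \<le> b" "\<kappa> * x - F x = 0"
    using IVT'[of "\<lambda>x. \<kappa> * x - F x" 0 0 b] b by auto
  moreover have "x \<noteq> 0" using x F_ge_1[of 0] by auto
  ultimately have "x > 0 \<and> F x = \<kappa> * x" by linarith
  then show ?thesis by blast
qed

text \<open>The root is unique because \<open>F(x) / x\<close> is decreasing; \<open>F\<close> lies above the line \<open>\<kappa> x\<close> before it and below
the line after it.\<close>

definition "x\<^sub>1 = (SOME x. x > 0 \<and> F x = \<kappa> * x)"

lemma x1: "x\<^sub>1 > 0" "F x\<^sub>1 = \<kappa> * x\<^sub>1"
  using someI_ex[OF root_exists] by (auto simp: x\<^sub>1_def)

lemma F_below_root: "0 \<le> x \<Longrightarrow> x \<le> x\<^sub>1 \<Longrightarrow> \<kappa> * x \<le> F x"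
proof (cases "x = 0")
  case False
  assume "0 \<le> x" "x \<le> x\<^sub>1"
  with False F_quotient_antimono[of x x\<^sub>1] x1 show ?thesis by (simp add: field_simps)
qed (use F_ge_1[of 0] in auto)

lemma F_above_root: "x\<^sub>1 \<le> x \<Longrightarrow> F x \<le> \<kappa> * x"
  using F_quotient_antimono[of x\<^sub>1 x] x1 by (simp add: field_simps)

text \<open>The size of the part \<open>\<epsilon>\<^sub>1 / (1 + x)\<close> of the perturbation: the bound by \<open>m M s / 2\<close> lets \<open>F_gap\<close> apply,
and the bound by \<open>1 / n\<close> keeps its own quadratic contribution below its linear one.\<close>

definition "\<epsilon>\<^sub>1 = min (1 / n) (m * M * s / 2)"

lemma eps1: "\<epsilon>\<^sub>1 > 0" "\<epsilon>\<^sub>1 \<le> 1 / n" "\<epsilon>\<^sub>1 \<le> m * M * s / 2"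
  using n M m_bounds s_bounds by (auto simp: \<epsilon>\<^sub>1_def)

lemma threshold_exists:
  "\<exists>X\<ge>x\<^sub>1. \<forall>x\<ge>X. 2 * F x\<^sub>1 \<le> F x \<and> F x \<le> \<kappa> * x / 2"
proof -
  have "eventually (\<lambda>x. 2 * F x\<^sub>1 \<le> F x) at_top"
    using F_at_top by (simp add: filterlim_at_top)
  moreover have "eventually (\<lambda>x. F x / x < \<kappa> / 2) at_top"
    using F_sublinear \<kappa>_bounds by (intro order_tendstoD(2)) auto
  then have "eventually (\<lambda>x. F x \<le> \<kappa> * x / 2) at_top"
    using eventually_gt_at_top[of 0] by eventually_elim (simp add: field_simps)
  ultimately have "eventually (\<lambda>x. 2 * F x\<^sub>1 \<le> F x \<and> F x \<le> \<kappa> * x / 2) at_top"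
    by eventually_elim simp
  then obtain X where "\<forall>x\<ge>X. 2 * F x\<^sub>1 \<le> F x \<and> F x \<le> \<kappa> * x / 2"
    by (auto simp: eventually_at_top_linorder)
  then show ?thesis by (intro exI[of _ "max X x\<^sub>1"]) auto
qed

text \<open>Beyond \<open>X\<^sub>0\<close> the concave function \<open>F\<close> is well above \<open>F(x\<^sub>1)\<close> and well below the line \<open>\<kappa> x\<close>.\<close>

definition "X\<^sub>0 = (SOME X. X \<ge> x\<^sub>1 \<and> (\<forall>x\<ge>X. 2 * F x\<^sub>1 \<le> F x \<and> F x \<le> \<kappa> * x / 2))"

lemma X0: "X\<^sub>0 \<ge> x\<^sub>1" "x \<ge> X\<^sub>0 \<Longrightarrow> 2 * F x\<^sub>1 \<le> F x" "x \<ge> X\<^sub>0 \<Longrightarrow> F x \<le> \<kappa> * x / 2"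
proof -
  have "X\<^sub>0 \<ge> x\<^sub>1 \<and> (\<forall>x\<ge>X\<^sub>0. 2 * F x\<^sub>1 \<le> F x \<and> F x \<le> \<kappa> * x / 2)"
    unfolding X\<^sub>0_def by (rule someI_ex[OF threshold_exists])
  then show "X\<^sub>0 \<ge> x\<^sub>1" "x \<ge> X\<^sub>0 \<Longrightarrow> 2 * F x\<^sub>1 \<le> F x" "x \<ge> X\<^sub>0 \<Longrightarrow> F x \<le> \<kappa> * x / 2"
    by blast+
qed

text \<open>The size of the linear part of the perturbation. The first bound keeps \<open>\<theta>\<close> decreasing on \<open>{0..X\<^sub>0}\<close>, the
second lets the product term dominate the lower order losses beyond \<open>X\<^sub>0\<close>.\<close>

definition "\<epsilon>\<^sub>2 = min (\<epsilon>\<^sub>1 / (2 * (1 + X\<^sub>0)\<^sup>2)) (m * \<kappa> / 24)"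

lemma eps2: "\<epsilon>\<^sub>2 > 0" "\<epsilon>\<^sub>2 \<le> \<epsilon>\<^sub>1 / (2 * (1 + X\<^sub>0)\<^sup>2)" "\<epsilon>\<^sub>2 \<le> m * \<kappa> / 24"
  using eps1 m_bounds \<kappa>_bounds X0(1) x1 by (auto simp: \<epsilon>\<^sub>2_def)

text \<open>The second summand of \<open>\<theta>\<close> is decreasing and makes \<open>reaction\<close> positive at \<open>x\<^sub>1\<close>; the first one grows
linearly and supplies a multiple of \<open>x\<^sup>2\<close> at infinity, which is missing when \<open>p\<close> is critical. Both
vanish at \<open>x\<^sub>1\<close>, so that they have a favourable sign against \<open>F(x) - \<kappa> x\<close> or can be absorbed.\<close>

definition "\<theta> x = \<epsilon>\<^sub>2 * (x - x\<^sub>1) + \<epsilon>\<^sub>1 * (1 / (1 + x) - 1 / (1 + x\<^sub>1))"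
definition "\<theta>' x = \<epsilon>\<^sub>2 - \<epsilon>\<^sub>1 / (1 + x)\<^sup>2"
definition "h x = - m * F x\<^sub>1 - m * \<kappa> * x + \<theta> x"
definition "h' x = - m * \<kappa> + \<theta>' x"

lemma h_has_derivative:
  assumes "x \<ge> 0"
  shows "(h has_real_derivative h' x) (at x)"
proof -
  have "((\<lambda>x. 1 / (1 + x)) has_real_derivative - (1 / (1 + x)\<^sup>2)) (at x)"
    using assms by (auto intro!: derivative_eq_intros simp: power2_eq_square)
  note d1 = this
  have d: "((\<lambda>x. \<epsilon>\<^sub>2 * (x - x\<^sub>1) + \<epsilon>\<^sub>1 * (1 / (1 + x) - 1 / (1 + x\<^sub>1))) has_real_derivative
      \<epsilon>\<^sub>2 + \<epsilon>\<^sub>1 * - (1 / (1 + x)\<^sup>2)) (at x)"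
    proof (intro DERIV_add DERIV_cmult)
    show "((\<lambda>x. \<epsilon>\<^sub>2 * (x - x\<^sub>1)) has_real_derivative \<epsilon>\<^sub>2) (at x)"
      by (auto intro!: derivative_eq_intros)
    show "((\<lambda>x. 1 / (1 + x) - 1 / (1 + x\<^sub>1)) has_real_derivative - (1 / (1 + x)\<^sup>2)) (at x)"
      using DERIV_diff[OF d1 DERIV_const[of "1 / (1 + x\<^sub>1)"]] by simp
  qed
  then have "((\<lambda>x. - m * F x\<^sub>1 - m * \<kappa> * x + (\<epsilon>\<^sub>2 * (x - x\<^sub>1) + \<epsilon>\<^sub>1 * (1 / (1 + x) - 1 / (1 + x\<^sub>1))))
      has_real_derivative (- m * \<kappa> + (\<epsilon>\<^sub>2 + \<epsilon>\<^sub>1 * - (1 / (1 + x)\<^sup>2)))) (at x)"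
    by (intro DERIV_add d) (auto intro!: derivative_eq_intros)
  then show ?thesis
    unfolding h_def[abs_def] \<theta>_def h'_def \<theta>'_def by simp
qed

definition "\<mu> x = 2 / n * F x + (p + 1 - 2 * m * \<kappa>) * x"
definition "\<beta> = m * \<kappa> * (p + 1 - 2 * \<kappa>)"
text \<open>\<open>reaction\<close> is what remains of the quadratic form \<open>Q\<close> below after completing the square in the Hessian,
see \<open>Q_eq\<close>. With \<open>\<theta> = 0\<close> it consists of its first summand and \<open>\<beta> x\<^sup>2\<close>.\<close>

definition "reaction x = (F x - \<kappa> * x) * (m * (F x\<^sub>1 - F x) - \<theta> x) + \<beta> * x\<^sup>2
    - x * \<theta>' x * \<mu> x - m * (x * \<theta>' x)\<^sup>2"

lemma m_\<kappa>: "2 * m * \<kappa> = 2 * \<kappa> - 2 * \<kappa> / n"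
  using n by (simp add: m_def field_simps)

lemma \<mu>_lower: "x \<ge> 0 \<Longrightarrow> \<mu> x \<ge> 2 / n * (1 + \<kappa> * x)"
proof -
  assume "x \<ge> 0"
  have "2 * \<kappa> / n * x \<le> (p + 1 - 2 * m * \<kappa>) * x"
    using \<open>x \<ge> 0\<close> m_\<kappa> \<kappa>_bounds by (intro mult_right_mono) auto
  moreover have "2 / n * 1 \<le> 2 / n * F x"
    using F_ge_1 n by (intro mult_left_mono) auto
  ultimately show ?thesis by (simp add: \<mu>_def algebra_simps)
qed

text \<open>Half of \<open>m (F(x\<^sub>1) - F(x))\<close> absorbs the bounded part of \<open>\<theta>\<close>: both change sign at \<open>x\<^sub>1\<close>, as does
\<open>F(x) - \<kappa> x\<close>.\<close>

lemma drift_part: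
  assumes "x \<ge> 0"
  shows "(F x - \<kappa> * x) * (m * (F x\<^sub>1 - F x) - \<theta> x)
     \<ge> (F x - \<kappa> * x) * (m / 2 * (F x\<^sub>1 - F x) - \<epsilon>\<^sub>2 * (x - x\<^sub>1))" (is "?A \<ge> ?B")
proof -
  define g where "g = 1 / (1 + x) - 1 / (1 + x\<^sub>1)"
  have "?A - ?B = (F x - \<kappa> * x) * (m / 2 * (F x\<^sub>1 - F x) - \<epsilon>\<^sub>1 * g)"
    by (simp add: \<theta>_def g_def algebra_simps)
  also have "\<dots> \<ge> 0"
  proof (cases "x \<le> x\<^sub>1")
    case True
    then have g: "g \<ge> 0" using assms x1 by (simp add: g_def divide_simps)
    have "\<epsilon>\<^sub>1 * g \<le> m * M * s / 2 * g"
      using g eps1 by (intro mult_right_mono) auto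
    also have "\<dots> = m / 2 * (M * s * g)" by simp
    also have "\<dots> \<le> m / 2 * (F x\<^sub>1 - F x)"
      using F_gap[OF assms True] m_bounds by (intro mult_left_mono) (auto simp: g_def)
    finally show ?thesis
      using F_below_root[OF assms True] by (intro mult_nonneg_nonneg) auto
  next
    case False
    then have g: "- g \<ge> 0" using assms x1 by (simp add: g_def divide_simps)
    have "\<epsilon>\<^sub>1 * (- g) \<le> m * M * s / 2 * (- g)"
      using g eps1 by (intro mult_right_mono) auto
    also have "\<dots> = m / 2 * (M * s * (- g))" by simp
    also have "\<dots> \<le> m / 2 * (F x - F x\<^sub>1)"
      using F_gap[of x\<^sub>1 x] x1 False m_bounds by (intro mult_left_mono) (auto simp: g_def)
    finally have "m / 2 * (F x\<^sub>1 - F x) - \<epsilon>\<^sub>1 * g \<le> 0" by (simp add: algebra_simps)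
    then show ?thesis
      using F_above_root[of x] False by (intro mult_nonpos_nonpos) auto
  qed
  finally show ?thesis by simp
qed

text \<open>Where \<open>\<theta>\<close> decreases, the term linear in its derivative is positive and dominates the quadratic one.\<close>

lemma \<theta>'_neg_part:
  assumes "x \<ge> 0" "\<theta>' x \<le> 0"
  shows "- x * \<theta>' x * \<mu> x - m * (x * \<theta>' x)\<^sup>2 \<ge> x * (- \<theta>' x) * (1 / n)"
proof -
  define \<rho> where "\<rho> = - \<theta>' x"
  have \<rho>: "\<rho> \<ge> 0" using assms by (simp add: \<rho>_def)
  have "x * \<rho> \<le> 1 / n"
  proof -
    have "\<rho> \<le> \<epsilon>\<^sub>1 / (1 + x)\<^sup>2" using eps2 by (simp add: \<rho>_def \<theta>'_def)
    then have "x * \<rho> \<le> x * (\<epsilon>\<^sub>1 / (1 + x)\<^sup>2)" using assms by (intro mult_left_mono)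
    also have "\<dots> = \<epsilon>\<^sub>1 * (x / (1 + x)\<^sup>2)" by simp
    also have "\<dots> \<le> \<epsilon>\<^sub>1 * 1"
      using assms eps1 by (intro mult_left_mono) (auto simp: divide_simps power2_eq_square algebra_simps)
    finally show ?thesis using eps1 by simp
  qed
  have "m * (x * \<rho>) \<le> 1 * (1 / n)"
    using \<open>x * \<rho> \<le> 1 / n\<close> m_bounds assms \<rho> by (intro mult_mono) auto
  moreover have "\<mu> x \<ge> 2 / n"
    using \<mu>_lower[OF assms(1)] assms \<kappa>_bounds n
    by (auto simp: field_simps intro: order_trans[rotated])
  ultimately have "1 / n \<le> \<mu> x - m * (x * \<rho>)" by (simp add: field_simps)
  then have "x * \<rho> * (1 / n) \<le> x * \<rho> * (\<mu> x - m * (x * \<rho>))"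
    using assms \<rho> by (intro mult_left_mono) auto
  then show ?thesis
    by (simp add: \<rho>_def power2_eq_square algebra_simps)
qed

text \<open>On \<open>{0..X\<^sub>0}\<close> all parts are nonnegative. The product is positive at \<open>0\<close> because \<open>M > 0\<close>, and the
derivative of \<open>\<theta>\<close> contributes a positive amount everywhere else, in particular at \<open>x\<^sub>1\<close>.\<close>

lemma reaction_pos_bounded:
  assumes "0 \<le> x" "x \<le> X\<^sub>0"
  shows "reaction x > 0"
proof -
  have "\<theta>' x < 0"
  proof -
    have "(1 + x)\<^sup>2 \<le> (1 + X\<^sub>0)\<^sup>2" using assms by (intro power_mono) auto
    then have "\<epsilon>\<^sub>1 / (2 * (1 + X\<^sub>0)\<^sup>2) \<le> \<epsilon>\<^sub>1 / (2 * (1 + x)\<^sup>2)"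
      using assms eps1 by (intro divide_left_mono) auto
    also have "\<dots> < \<epsilon>\<^sub>1 / (1 + x)\<^sup>2"
      using assms eps1(1) by (intro divide_strict_left_mono) auto
    finally show ?thesis using eps2(2) unfolding \<theta>'_def by linarith
  qed
  have "0 \<le> \<beta> * x\<^sup>2"
    using m_bounds \<kappa>_bounds by (simp add: \<beta>_def)
  have drift: "(F x - \<kappa> * x) * (m / 2 * (F x\<^sub>1 - F x) - \<epsilon>\<^sub>2 * (x - x\<^sub>1)) \<ge> 0"
  proof (cases "x \<le> x\<^sub>1")
    case True
    have "0 \<le> m / 2 * (F x\<^sub>1 - F x)"
      using F_mono[OF assms(1) True] m_bounds by simp
    moreover have "\<epsilon>\<^sub>2 * (x - x\<^sub>1) \<le> 0"
      using True eps2(1) by (simp add: mult_nonneg_nonpos)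
    ultimately show ?thesis
      using F_below_root[OF assms(1) True] by (intro mult_nonneg_nonneg) auto
  next
    case False
    have "m / 2 * (F x\<^sub>1 - F x) \<le> 0"
      using F_mono[of x\<^sub>1 x] False x1 m_bounds by (intro mult_nonneg_nonpos) auto
    moreover have "\<epsilon>\<^sub>2 * (x - x\<^sub>1) \<ge> 0"
      using False eps2(1) by simp
    ultimately show ?thesis
      using F_above_root[of x] False by (intro mult_nonpos_nonpos) auto
  qed
  show ?thesis
  proof (cases "x = 0")
    case True
    have "F 0 = 1" using s_bounds by (simp add: F_def)
    have "F x\<^sub>1 > 1" using x1(1) M by (simp add: F_def)
    have "0 < m / 2 * (F x\<^sub>1 - F 0) - \<epsilon>\<^sub>2 * (0 - x\<^sub>1)"
      using \<open>F 0 = 1\<close> \<open>F x\<^sub>1 > 1\<close> m_bounds eps2(1) x1(1) by (simp add: add_pos_pos)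
    with drift_part[of 0] show ?thesis
      using \<open>F 0 = 1\<close> True by (simp add: reaction_def)
  next
    case False
    then have "x * (- \<theta>' x) * (1 / n) > 0"
      using assms n \<open>\<theta>' x < 0\<close> by (intro mult_pos_pos) auto
    then show ?thesis
      using \<theta>'_neg_part[OF assms(1)] \<open>\<theta>' x < 0\<close> drift drift_part[OF assms(1)] \<open>0 \<le> \<beta> * x\<^sup>2\<close>
      by (simp add: reaction_def)
  qed
qed

text \<open>For large \<open>x\<close> the product term is of order \<open>x F(x)\<close> and absorbs all losses of that order; the terms
quadratic in \<open>x\<close> have a positive total coefficient, namely at least \<open>\<epsilon>\<^sub>2 \<kappa> / 6\<close>.\<close>

lemma reaction_lower_far:
  assumes "x \<ge> X\<^sub>0"
  shows "reaction x \<ge> \<epsilon>\<^sub>2 * \<kappa> / 6 * x\<^sup>2"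
proof -
  have x: "x > 0" "x \<ge> x\<^sub>1" using assms X0(1) x1 by auto
  have F1: "\<kappa> * x\<^sub>1 \<le> F x / 2" and F2: "F x \<le> \<kappa> * x / 2"
    using X0(2,3)[OF assms] x1 by auto
  define b where "b = p + 1 - 2 * \<kappa>"
  have "b \<ge> 0" using \<kappa>_bounds by (simp add: b_def)
  \<comment> \<open>If \<open>\<theta>\<close> still decreases at \<open>x\<close>, the left side is nonnegative anyway; otherwise \<open>0 < \<theta>' x \<le> \<epsilon>\<^sub>2\<close>.\<close>
  have tail: "- x * \<theta>' x * \<mu> x - m * (x * \<theta>' x)\<^sup>2 \<ge> - \<epsilon>\<^sub>2 * x * \<mu> x - m * (\<epsilon>\<^sub>2 * x)\<^sup>2"
  proof (cases "\<theta>' x \<le> 0")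
    case True
    have "\<mu> x \<ge> 0" using \<mu>_lower[of x] x \<kappa>_bounds n by (auto intro: order_trans[rotated])
    then have "0 \<le> \<epsilon>\<^sub>2 * x * \<mu> x" "0 \<le> m * (\<epsilon>\<^sub>2 * x)\<^sup>2"
      using eps2(1) x m_bounds by (intro mult_nonneg_nonneg; simp)+
    then have "- \<epsilon>\<^sub>2 * x * \<mu> x - m * (\<epsilon>\<^sub>2 * x)\<^sup>2 \<le> 0"
      by simp
    also have "0 \<le> x * (- \<theta>' x) * (1 / n)" using True x n by (intro mult_nonneg_nonneg) auto
    also note \<theta>'_neg_part[OF _ True]
    finally show ?thesis using x by simp
  next
    case False
    have "\<theta>' x \<le> \<epsilon>\<^sub>2" using eps1(1) by (simp add: \<theta>'_def)
    have "x * \<theta>' x \<le> x * \<epsilon>\<^sub>2" using x \<open>\<theta>' x \<le> \<epsilon>\<^sub>2\<close> by simp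
    moreover have "\<mu> x \<ge> 0" using \<mu>_lower[of x] x \<kappa>_bounds n by (auto intro: order_trans[rotated])
    ultimately have "x * \<theta>' x * \<mu> x \<le> x * \<epsilon>\<^sub>2 * \<mu> x" by (intro mult_right_mono)
    moreover have "m * (x * \<theta>' x)\<^sup>2 \<le> m * (x * \<epsilon>\<^sub>2)\<^sup>2"
      using False x m_bounds \<open>x * \<theta>' x \<le> x * \<epsilon>\<^sub>2\<close> by (intro mult_left_mono power_mono) auto
    ultimately show ?thesis by (simp add: algebra_simps)
  qed
  have "(\<kappa> * x - F x) * (m / 2 * (F x - F x\<^sub>1)) \<ge> (\<kappa> * x / 2) * (m / 2 * (F x / 2))"
    using F2 X0(2)[OF assms] F_ge_1[of x] m_bounds x \<kappa>_bounds
    by (intro mult_mono mult_left_mono) (auto simp: mult.commute)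
  then have main: "(\<kappa> * x - F x) * (m / 2 * (F x - F x\<^sub>1)) \<ge> m * \<kappa> / 8 * (x * F x)"
    by (simp add: algebra_simps)
  have xF: "x * F x \<ge> 0" using x F_ge_1[of x] by simp
  have lower_order: "\<epsilon>\<^sub>2 * (\<kappa> * x * x\<^sub>1 + F x * (x - x\<^sub>1) + 2 / n * x * F x) \<le> m * \<kappa> / 8 * (x * F x)"
  proof -
    have "\<kappa> * x * x\<^sub>1 \<le> (x * F x) * (1 / 2)"
      using mult_left_mono[OF F1, of x] x by (simp add: algebra_simps)
    moreover have "F x * (x - x\<^sub>1) \<le> x * F x"
      using F_ge_1[of x] x1 by (simp add: algebra_simps)
    moreover have "2 / n * (x * F x) \<le> 2 / 3 * (x * F x)"
      using xF n by (intro mult_right_mono) (auto simp: field_simps)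
    ultimately have "\<kappa> * x * x\<^sub>1 + F x * (x - x\<^sub>1) + 2 / n * x * F x \<le> 3 * (x * F x)"
      using xF by simp
    then have "\<epsilon>\<^sub>2 * (\<kappa> * x * x\<^sub>1 + F x * (x - x\<^sub>1) + 2 / n * x * F x) \<le> \<epsilon>\<^sub>2 * (3 * (x * F x))"
      using eps2(1) by (intro mult_left_mono) auto
    also have "\<dots> \<le> m * \<kappa> / 24 * (3 * (x * F x))"
      using eps2(3) xF by (intro mult_right_mono) auto
    also have "\<dots> = m * \<kappa> / 8 * (x * F x)" by simp
    finally show ?thesis .
  qed
  have quad: "\<epsilon>\<^sub>2 * \<kappa> / 6 \<le> \<epsilon>\<^sub>2 * \<kappa> + \<beta> - \<epsilon>\<^sub>2 * (b + 2 * \<kappa> / n) - m * \<epsilon>\<^sub>2\<^sup>2"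
  proof -
    have "m * \<kappa> > 0" using m_bounds \<kappa>_bounds by simp
    then have "\<epsilon>\<^sub>2 \<le> m * \<kappa>" using eps2(3) by linarith
    then have "\<epsilon>\<^sub>2 * b \<le> m * \<kappa> * b"
      using \<open>b \<ge> 0\<close> by (rule mult_right_mono)
    then have "\<epsilon>\<^sub>2 * b \<le> \<beta>" by (simp add: \<beta>_def b_def)
    moreover have "\<epsilon>\<^sub>2 * (2 * \<kappa> / n) \<le> \<epsilon>\<^sub>2 * (2 * \<kappa> / 3)"
      using eps2(1) \<kappa>_bounds n by (intro mult_left_mono divide_left_mono) auto
    moreover have "m * \<epsilon>\<^sub>2\<^sup>2 \<le> \<epsilon>\<^sub>2 * \<kappa> / 24"
    proof -
      have "m * \<kappa> \<le> 1 * \<kappa>" using m_bounds \<kappa>_bounds by (intro mult_right_mono) auto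
      then have "\<epsilon>\<^sub>2 \<le> \<kappa> / 24" using eps2(3) by simp
      then have "m * (\<epsilon>\<^sub>2 * \<epsilon>\<^sub>2) \<le> 1 * (\<epsilon>\<^sub>2 * (\<kappa> / 24))"
        using m_bounds eps2(1) by (intro mult_mono mult_left_mono) auto
      then show ?thesis by (simp add: power2_eq_square)
    qed
    moreover have "\<epsilon>\<^sub>2 * \<kappa> > 0" using eps2(1) \<kappa>_bounds by simp
    moreover have "\<epsilon>\<^sub>2 * (b + 2 * \<kappa> / n) = \<epsilon>\<^sub>2 * b + \<epsilon>\<^sub>2 * (2 * \<kappa> / n)" by (rule distrib_left)
    moreover have "\<epsilon>\<^sub>2 * (2 * \<kappa> / 3) = 2 / 3 * (\<epsilon>\<^sub>2 * \<kappa>)" by simp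
    ultimately show ?thesis by linarith
  qed
  have "\<epsilon>\<^sub>2 * \<kappa> / 6 * x\<^sup>2 \<le> (\<epsilon>\<^sub>2 * \<kappa> + \<beta> - \<epsilon>\<^sub>2 * (b + 2 * \<kappa> / n) - m * \<epsilon>\<^sub>2\<^sup>2) * x\<^sup>2"
    using quad by (intro mult_right_mono) auto
  also have "\<dots> \<le> (\<kappa> * x - F x) * (m / 2 * (F x - F x\<^sub>1))
      - \<epsilon>\<^sub>2 * (\<kappa> * x * x\<^sub>1 + F x * (x - x\<^sub>1) + 2 / n * x * F x)
      + (\<epsilon>\<^sub>2 * \<kappa> + \<beta> - \<epsilon>\<^sub>2 * (b + 2 * \<kappa> / n) - m * \<epsilon>\<^sub>2\<^sup>2) * x\<^sup>2"
    using order_trans[OF lower_order main] by simp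
  also have "\<dots> = (F x - \<kappa> * x) * (m / 2 * (F x\<^sub>1 - F x) - \<epsilon>\<^sub>2 * (x - x\<^sub>1)) + \<beta> * x\<^sup>2
      + (- \<epsilon>\<^sub>2 * x * \<mu> x - m * (\<epsilon>\<^sub>2 * x)\<^sup>2)"
  proof -
    have "\<mu> x = 2 / n * F x + (b + 2 * \<kappa> / n) * x"
      unfolding \<mu>_def m_\<kappa> b_def by simp
    moreover define k where "k = m / 2"
    ultimately show ?thesis unfolding k_def[symmetric]
      by (simp only:) (simp add: algebra_simps power2_eq_square)
  qed
  also have "\<dots> \<le> reaction x"
    using drift_part[of x] tail x by (simp add: reaction_def)
  finally show ?thesis .
qed

lemma reaction_coercive: "\<exists>\<delta>>0. \<forall>x\<ge>0. reaction x \<ge> \<delta> * (1 + x\<^sup>2)"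
proof -
  have X: "X\<^sub>0 > 0" using X0(1) x1 by simp
  have "continuous_on {0..X\<^sub>0} reaction"
    unfolding reaction_def \<theta>_def \<theta>'_def \<mu>_def
    by (intro continuous_intros continuous_on_subset[OF F_continuous]) auto
  then obtain y where y: "y \<in> {0..X\<^sub>0}" "\<And>x. x \<in> {0..X\<^sub>0} \<Longrightarrow> reaction y \<le> reaction x"
    using continuous_attains_inf[of "{0..X\<^sub>0}" reaction] X by auto
  define c where "c = \<epsilon>\<^sub>2 * \<kappa> / 6"
  have "c > 0" using eps2(1) \<kappa>_bounds by (simp add: c_def)
  define \<delta> where "\<delta> = min (reaction y / (1 + X\<^sub>0\<^sup>2)) (c * X\<^sub>0\<^sup>2 / (1 + X\<^sub>0\<^sup>2))"
  have ry: "reaction y > 0" using y(1) by (intro reaction_pos_bounded) auto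
  have pos: "1 + X\<^sub>0\<^sup>2 > 0" by (simp add: add_pos_nonneg)
  have "\<delta> > 0" using ry \<open>c > 0\<close> X pos by (simp add: \<delta>_def)
  moreover have "reaction x \<ge> \<delta> * (1 + x\<^sup>2)" if "x \<ge> 0" for x
  proof (cases "x \<le> X\<^sub>0")
    case True
    have "x\<^sup>2 \<le> X\<^sub>0\<^sup>2" using that True by (intro power_mono)
    have "\<delta> * (1 + x\<^sup>2) \<le> reaction y / (1 + X\<^sub>0\<^sup>2) * (1 + X\<^sub>0\<^sup>2)"
      using \<open>x\<^sup>2 \<le> X\<^sub>0\<^sup>2\<close> ry pos by (intro mult_mono) (auto simp: \<delta>_def)
    also have "\<dots> = reaction y" using pos by simp
    also have "\<dots> \<le> reaction x" using y(2) that True by simp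
    finally show ?thesis .
  next
    case False
    then have "X\<^sub>0\<^sup>2 \<le> x\<^sup>2" using X by (intro power_mono) auto
    have "\<delta> * (1 + x\<^sup>2) \<le> c * X\<^sub>0\<^sup>2 / (1 + X\<^sub>0\<^sup>2) * (1 + x\<^sup>2)"
      by (intro mult_right_mono) (auto simp: \<delta>_def)
    also have "\<dots> \<le> c * x\<^sup>2"
    proof -
      have "X\<^sub>0\<^sup>2 * (1 + x\<^sup>2) \<le> x\<^sup>2 * (1 + X\<^sub>0\<^sup>2)"
        using \<open>X\<^sub>0\<^sup>2 \<le> x\<^sup>2\<close> by (simp add: algebra_simps)
      then have "c * (X\<^sub>0\<^sup>2 * (1 + x\<^sup>2)) \<le> c * (x\<^sup>2 * (1 + X\<^sub>0\<^sup>2))"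
        using \<open>c > 0\<close> by (intro mult_left_mono) auto
      then show ?thesis using pos by (simp add: divide_le_eq algebra_simps)
    qed
    also have "\<dots> \<le> reaction x" using reaction_lower_far[of x] False by (simp add: c_def)
    finally show ?thesis .
  qed
  ultimately show ?thesis by blast
qed

end

section \<open>Coercivity of the quadratic form in the Hessian\<close>

lemma sum_norm_square_complete:
  fixes V :: "'n::finite \<Rightarrow> real ^ 'n" and b :: "real ^ 'n"
  shows "(\<Sum>i\<in>UNIV. (norm (V i - c *\<^sub>R axis i 1 - (B * b $ i) *\<^sub>R b))\<^sup>2)
    = (\<Sum>i\<in>UNIV. V i \<bullet> V i) - 2 * c * (\<Sum>i\<in>UNIV. V i $ i) - 2 * B * (b \<bullet> (\<chi> i. V i \<bullet> b))
      + real CARD('n) * c\<^sup>2 + 2 * c * B * (b \<bullet> b) + B\<^sup>2 * (b \<bullet> b)\<^sup>2"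
proof -
  have "(norm (V i - c *\<^sub>R axis i 1 - (B * b $ i) *\<^sub>R b))\<^sup>2
     = V i \<bullet> V i + (- 2 * c) * (V i $ i) + (- 2 * B) * (b $ i * (V i \<bullet> b)) + c\<^sup>2
       + (2 * c * B) * (b $ i * b $ i) + (B\<^sup>2 * (b \<bullet> b)) * (b $ i * b $ i)" for i
    unfolding power2_norm_eq_inner
    by (simp add: inner_diff_left inner_diff_right inner_axis inner_axis'
        inner_commute[of b "V i"] algebra_simps power2_eq_square)
  then have "(\<Sum>i\<in>UNIV. (norm (V i - c *\<^sub>R axis i 1 - (B * b $ i) *\<^sub>R b))\<^sup>2)
     = (\<Sum>i\<in>UNIV. V i \<bullet> V i) + (- 2 * c) * (\<Sum>i\<in>UNIV. V i $ i) + (- 2 * B) * (\<Sum>i\<in>UNIV. b $ i * (V i \<bullet> b))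
       + real CARD('n) * c\<^sup>2 + (2 * c * B) * (\<Sum>i\<in>UNIV. b $ i * b $ i) + (B\<^sup>2 * (b \<bullet> b)) * (\<Sum>i\<in>UNIV. b $ i * b $ i)"
    by (simp only: sum.distrib sum_distrib_left[symmetric] sum_constant)
  then show ?thesis
    by (simp add: inner_vec_def power2_eq_square)
qed

text \<open>Young's inequality with exponents 4 and 4/3, followed by raising the exponent from 4 to \<open>K\<close>. The latter
is possible because \<open>W \<ge> 1\<close>: either the gradient term is absorbed at once, or \<open>l / \<eta>\<close> is bounded below.\<close>

lemma young_quarter:
  fixes \<eta> l W K C \<delta> :: real
  assumes "\<delta> > 0" "C > 0" "W \<ge> 1" "\<eta> > 0" "l \<ge> 0" "K \<ge> 4"
  shows "\<delta> * \<eta> * W - C * l * W powr (3 / 4)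
     \<ge> \<delta> / 2 * \<eta> - \<delta> / 2 * (2 * C / \<delta>) powr K * (\<eta> * (l / \<eta>) powr K)"
proof -
  define t where "t = W powr (1 / 4)"
  have t: "t \<ge> 1" using assms by (simp add: t_def ge_one_powr_ge_zero)
  have W: "W = t ^ 4" "W powr (3 / 4) = t ^ 3"
    using assms t by (auto simp: t_def powr_powr simp flip: powr_numeral)
  \<comment> \<open>The gradient term is absorbed exactly when \<open>r \<le> t\<close>.\<close>
  define r where "r = 2 * C / \<delta> * (l / \<eta>)"
  have r: "r \<ge> 0" using assms by (simp add: r_def)
  have rK: "(2 * C / \<delta>) powr K * (l / \<eta>) powr K = r powr K"
    unfolding r_def by (rule powr_mult[symmetric]; use assms in simp)
  have Cl: "C * l = \<delta> / 2 * \<eta> * r" using assms by (simp add: r_def)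
  have "t ^ 4 - r * t ^ 3 / 2 \<ge> 1 / 2 - r powr K / 2"
  proof (cases "r \<le> t")
    case True
    have "r * t ^ 3 \<le> t * t ^ 3" using True t by (intro mult_right_mono) auto
    moreover have "t * t ^ 3 = t ^ 4" by (simp add: numeral_eq_Suc)
    moreover have "t ^ 4 \<ge> 1" using t by (rule one_le_power)
    moreover have "r powr K \<ge> 0" by simp
    ultimately show ?thesis by linarith
  next
    case False
    then have "r * t ^ 3 \<le> r * r ^ 3"
      using t by (intro mult_left_mono power_mono) auto
    also have "\<dots> = r powr 4" using False t by (simp add: numeral_eq_Suc flip: powr_realpow)
    also have "\<dots> \<le> r powr K" using False t assms by (intro powr_mono) auto
    finally have "r * t ^ 3 \<le> r powr K" .
    moreover have "t ^ 4 \<ge> 1" using t by (rule one_le_power)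
    ultimately show ?thesis by linarith
  qed
  then have "\<delta> * \<eta> * (1 / 2 - r powr K / 2) \<le> \<delta> * \<eta> * (t ^ 4 - r * t ^ 3 / 2)"
    using assms by (intro mult_left_mono) auto
  also have "\<dots> = \<delta> * \<eta> * W - C * l * W powr (3 / 4)"
    unfolding Cl W(2) using W(1) by (simp add: algebra_simps)
  also have "\<delta> * \<eta> * (1 / 2 - r powr K / 2) = \<delta> / 2 * \<eta> - \<delta> / 2 * (2 * C / \<delta>) powr K * (\<eta> * (l / \<eta>) powr K)"
    unfolding rK[symmetric] by (simp add: algebra_simps)
  finally show ?thesis .
qed

text \<open>The identity behind \<open>Q_eq\<close>, with \<open>i = 1 / n\<close>, \<open>k = \<kappa>\<close>, \<open>f = F(x)\<close>, \<open>f1 = F(x\<^sub>1)\<close>, \<open>t = \<theta>(x)\<close> and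
\<open>B = \<kappa> - \<theta>'(x)\<close>. In this form it is a polynomial identity.\<close>

lemma square_completion_identity:
  fixes p m k i f f1 x t B X :: real
  assumes "p = k * (1 + 2 * i)" and "m = 1 - i"
  shows "- f\<^sup>2 + (k - p) * (X + x * f) + (k * x - f) * (- m * f1 - m * k * x + t)
       + (- m * k + (k - B)) * (2 * X - (p + 1) * x\<^sup>2)
     = 2 * (- i * (f + B * x)) * f - 2 * B * X + i * (f + B * x)\<^sup>2
       + 2 * (- i * (f + B * x)) * B * x + B\<^sup>2 * x\<^sup>2
       + ((f - k * x) * (m * (f1 - f) - t) + m * k * (p + 1 - 2 * k) * x\<^sup>2
          - x * (k - B) * (2 * i * f + (p + 1 - 2 * m * k) * x) - m * (x * (k - B))\<^sup>2)"
  unfolding assms by (simp add: algebra_simps power2_eq_square)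

context exponents
begin

text \<open>\<open>V\<close> is the Hessian divided by \<open>v\<^sup>p\<close> and \<open>b\<close> the gradient divided by \<open>v\<close> to the power \<open>(p + 1) / 2\<close>.\<close>

definition Q :: "('n::finite \<Rightarrow> real ^ 'n) \<Rightarrow> real ^ 'n \<Rightarrow> real" where
  "Q V b = (let x = b \<bullet> b; X = b \<bullet> (\<chi> i. V i \<bullet> b) in
     (\<Sum>i\<in>UNIV. V i \<bullet> V i) - (F x)\<^sup>2 + (\<kappa> - p) * (X + x * F x)
     + (\<kappa> * x - F x) * h x + h' x * (2 * X - (p + 1) * x\<^sup>2))"

text \<open>For a given trace, the part of \<open>Q\<close> that depends on \<open>V\<close> is smallest when \<open>V\<close> is a combination of the
identity and \<open>b \<otimes> b\<close>. The factor \<open>B\<close> is read off from the coefficient of the mixed term, and \<open>c\<close> from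
the trace.\<close>

lemma Q_eq:
  fixes V :: "'n::finite \<Rightarrow> real ^ 'n"
  assumes "n = real CARD('n)" and trace: "(\<Sum>i\<in>UNIV. V i $ i) = - F (b \<bullet> b)"
  defines "B \<equiv> \<kappa> - \<theta>' (b \<bullet> b)"
  defines "c \<equiv> - (F (b \<bullet> b) + B * (b \<bullet> b)) / n"
  shows "Q V b = (\<Sum>i\<in>UNIV. (norm (V i - c *\<^sub>R axis i 1 - (B * b $ i) *\<^sub>R b))\<^sup>2) + reaction (b \<bullet> b)"
proof -
  define x where "x = b \<bullet> b"
  define X where "X = b \<bullet> (\<chi> i. V i \<bullet> b)"
  define i where "i = 1 / n"
  have "1 + 2 * i = (n + 2) / n" using n by (simp add: i_def field_simps)
  then have p_i: "p = \<kappa> * (1 + 2 * i)" using n by (simp add: \<kappa>_def)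
  have m_i: "m = 1 - i" using n by (simp add: m_def i_def field_simps)
  have n_c2: "n * c\<^sup>2 = i * (F x + B * x)\<^sup>2" and c_i: "c = - i * (F x + B * x)"
    using n by (auto simp: c_def x_def i_def power2_eq_square field_simps)
  have D: "(\<Sum>i\<in>UNIV. (norm (V i - c *\<^sub>R axis i 1 - (B * b $ i) *\<^sub>R b))\<^sup>2)
     = (\<Sum>i\<in>UNIV. V i \<bullet> V i) + 2 * c * F x - 2 * B * X + i * (F x + B * x)\<^sup>2
       + 2 * c * B * x + B\<^sup>2 * x\<^sup>2"
    unfolding sum_norm_square_complete trace
    using n_c2 assms(1) by (simp add: x_def X_def)
  have \<theta>': "\<theta>' x = \<kappa> - B" by (simp add: B_def x_def)
  have \<mu>: "\<mu> x = 2 * i * F x + (p + 1 - 2 * m * \<kappa>) * x" by (simp add: \<mu>_def i_def)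
  have "Q V b - (\<Sum>i\<in>UNIV. V i \<bullet> V i) = - (F x)\<^sup>2 + (\<kappa> - p) * (X + x * F x)
     + (\<kappa> * x - F x) * h x + h' x * (2 * X - (p + 1) * x\<^sup>2)"
    by (simp add: Q_def Let_def x_def X_def)
  also have "\<dots> = 2 * c * F x - 2 * B * X + i * (F x + B * x)\<^sup>2
       + 2 * c * B * x + B\<^sup>2 * x\<^sup>2 + reaction x"
    unfolding h_def h'_def reaction_def \<beta>_def \<mu> \<theta>' c_i
    by (rule square_completion_identity[OF p_i m_i])
  finally show ?thesis unfolding D x_def[symmetric] by simp
qed

lemma F_linear_bound: "x \<ge> 0 \<Longrightarrow> F x \<le> (1 + M) * (1 + x)"
proof -
  assume x: "x \<ge> 0"
  have "x powr s \<le> (1 + x) powr s" using x s_bounds by (intro powr_mono2) auto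
  also have "\<dots> \<le> (1 + x) powr 1" using x s_bounds by (intro powr_mono) auto
  finally have "M * x powr s \<le> M * (1 + x)" using x M by (intro mult_left_mono) auto
  then show "F x \<le> (1 + M) * (1 + x)" using x by (simp add: F_def algebra_simps)
qed

lemma \<theta>'_bound: "x \<ge> 0 \<Longrightarrow> \<bar>\<theta>' x\<bar> \<le> \<epsilon>\<^sub>1 + \<epsilon>\<^sub>2"
proof -
  assume x: "x \<ge> 0"
  have "\<epsilon>\<^sub>1 / (1 + x)\<^sup>2 \<le> \<epsilon>\<^sub>1 / 1"
    using x eps1 by (intro divide_left_mono) (auto simp: one_le_power)
  moreover have "0 \<le> \<epsilon>\<^sub>1 / (1 + x)\<^sup>2" using eps1 by simp
  ultimately show ?thesis using eps1(1) eps2(1) unfolding \<theta>'_def by linarith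
qed

lemma h_linear_bound: "\<exists>C>0. \<forall>x\<ge>0. \<bar>h x\<bar> \<le> C * (1 + x)"
proof -
  define C where "C = m * F x\<^sub>1 + m * \<kappa> + \<epsilon>\<^sub>2 + \<epsilon>\<^sub>2 * x\<^sub>1 + \<epsilon>\<^sub>1"
  have pos: "m * F x\<^sub>1 > 0" "m * \<kappa> > 0" "\<epsilon>\<^sub>2 * x\<^sub>1 > 0" "\<epsilon>\<^sub>1 > 0" "\<epsilon>\<^sub>2 > 0"
    using m_bounds \<kappa>_bounds F_ge_1[of x\<^sub>1] eps1(1) eps2(1) x1(1) by (auto intro!: mult_pos_pos)
  have "\<bar>h x\<bar> \<le> C * (1 + x)" if x: "x \<ge> 0" for x
  proof -
    have g: "\<bar>1 / (1 + x) - 1 / (1 + x\<^sub>1)\<bar> \<le> 1"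
    proof -
      have "0 \<le> 1 / (1 + x)" "1 / (1 + x) \<le> 1" "0 \<le> 1 / (1 + x\<^sub>1)" "1 / (1 + x\<^sub>1) \<le> 1"
        using x x1(1) by auto
      then show ?thesis by linarith
    qed
    have "\<bar>\<epsilon>\<^sub>1 * (1 / (1 + x) - 1 / (1 + x\<^sub>1))\<bar> \<le> \<epsilon>\<^sub>1 * 1"
      unfolding abs_mult using g pos by (intro mult_mono) auto
    moreover have "h x = - (m * F x\<^sub>1) - (m * \<kappa>) * x + (\<epsilon>\<^sub>2 * x - \<epsilon>\<^sub>2 * x\<^sub>1) + \<epsilon>\<^sub>1 * (1 / (1 + x) - 1 / (1 + x\<^sub>1))"
      by (simp add: h_def \<theta>_def algebra_simps)
    moreover have "0 \<le> (m * \<kappa>) * x" "0 \<le> \<epsilon>\<^sub>2 * x" using pos x by auto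
    ultimately have "\<bar>h x\<bar> \<le> m * F x\<^sub>1 + (m * \<kappa>) * x + \<epsilon>\<^sub>2 * x + \<epsilon>\<^sub>2 * x\<^sub>1 + \<epsilon>\<^sub>1"
      using pos by linarith
    also have "\<dots> \<le> C * (1 + x)"
    proof -
      have "0 \<le> (m * F x\<^sub>1) * x" "0 \<le> (\<epsilon>\<^sub>2 * x\<^sub>1) * x" "0 \<le> \<epsilon>\<^sub>1 * x" using pos x by auto
      moreover have "C * (1 + x) = m * F x\<^sub>1 + m * \<kappa> + \<epsilon>\<^sub>2 + \<epsilon>\<^sub>2 * x\<^sub>1 + \<epsilon>\<^sub>1 +
         ((m * F x\<^sub>1) * x + (m * \<kappa>) * x + \<epsilon>\<^sub>2 * x + (\<epsilon>\<^sub>2 * x\<^sub>1) * x + \<epsilon>\<^sub>1 * x)"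
        by (simp add: C_def algebra_simps)
      ultimately show ?thesis using pos by linarith
    qed
    finally show ?thesis .
  qed
  moreover have "C > 0" using pos by (simp add: C_def)
  ultimately show ?thesis by blast
qed

text \<open>By \<open>Q_eq\<close> the form controls \<open>1 + x\<^sup>2\<close> and the distance of \<open>V\<close> from the minimizing matrix \<open>A\<close>. The norm of
\<open>A\<close> is at most a constant times \<open>1 + x\<close>, so \<open>V\<close> itself is controlled as well.\<close>

lemma Q_coercive:
  assumes "n = real CARD('n::finite)"
  shows "\<exists>\<delta>>0. \<forall>(V :: 'n \<Rightarrow> real ^ 'n) b. (\<Sum>i\<in>UNIV. V i $ i) = - F (b \<bullet> b) \<longrightarrow>
      Q V b \<ge> \<delta> * (1 + (b \<bullet> b)\<^sup>2 + (\<Sum>i\<in>UNIV. V i \<bullet> V i))"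
proof -
  obtain d where d: "d > 0" "\<And>x. x \<ge> 0 \<Longrightarrow> reaction x \<ge> d * (1 + x\<^sup>2)"
    using reaction_coercive by blast
  define CB where "CB = \<kappa> + \<epsilon>\<^sub>1 + \<epsilon>\<^sub>2"
  define Cc where "Cc = 1 + M + CB"
  define C where "C = 8 * (n * Cc\<^sup>2 + CB\<^sup>2)"
  have CB: "CB > 0" using \<kappa>_bounds eps1(1) eps2(1) by (simp add: CB_def)
  then have "C > 0" using n M by (simp add: C_def Cc_def add_pos_pos)
  define \<delta> where "\<delta> = min (1 / 2) (d / (1 + C))"
  have "\<delta> > 0" using d(1) \<open>C > 0\<close> by (simp add: \<delta>_def)
  moreover have "\<delta> \<le> 1 / 2" unfolding \<delta>_def by (rule min.cobounded1)
  ultimately have \<delta>: "\<delta> > 0" "\<delta> \<le> 1 / 2" .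
  have "\<delta> * (1 + C) \<le> d / (1 + C) * (1 + C)"
    using \<open>C > 0\<close> by (intro mult_right_mono) (auto simp: \<delta>_def)
  then have \<delta>C: "\<delta> * (1 + C) \<le> d" using \<open>C > 0\<close> by simp
  have "Q V b \<ge> \<delta> * (1 + (b \<bullet> b)\<^sup>2 + (\<Sum>i\<in>UNIV. V i \<bullet> V i))"
    if trace: "(\<Sum>i\<in>UNIV. V i $ i) = - F (b \<bullet> b)" for V :: "'n \<Rightarrow> real ^ 'n" and b
  proof -
    define x where "x = b \<bullet> b"
    have x: "x \<ge> 0" by (simp add: x_def)
    define B where "B = \<kappa> - \<theta>' x"
    define c where "c = - (F x + B * x) / n"
    define A where "A = (\<lambda>i. c *\<^sub>R axis i 1 + (B * b $ i) *\<^sub>R b)"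
    define D where "D = (\<Sum>i\<in>UNIV. (norm (V i - A i))\<^sup>2)"
    have QD: "Q V b = D + reaction x"
      using Q_eq[OF assms trace] by (simp add: D_def A_def c_def B_def x_def diff_diff_eq)
    have B: "\<bar>B\<bar> \<le> CB" using \<theta>'_bound[OF x] \<kappa>_bounds by (simp add: B_def CB_def)
    have "\<bar>F x + B * x\<bar> \<le> (1 + M) * (1 + x) + CB * (1 + x)"
    proof -
      have "\<bar>B * x\<bar> \<le> CB * (1 + x)"
        unfolding abs_mult using B x CB by (intro mult_mono) auto
      then show ?thesis using F_linear_bound[OF x] F_ge_1[of x] by linarith
    qed
    then have "\<bar>F x + B * x\<bar> \<le> Cc * (1 + x)" by (simp add: Cc_def algebra_simps)
    moreover have "\<bar>c\<bar> \<le> \<bar>F x + B * x\<bar>"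
    proof -
      have "\<bar>F x + B * x\<bar> / n \<le> \<bar>F x + B * x\<bar> / 1"
        using n by (intro divide_left_mono) auto
      then show ?thesis using n unfolding c_def abs_divide abs_minus_cancel by simp
    qed
    ultimately have c: "\<bar>c\<bar> \<le> Cc * (1 + x)" by linarith
    have 1: "(1 + x)\<^sup>2 \<le> 2 * (1 + x\<^sup>2)"
      using sum_squares_bound[of 1 x] by (simp add: power2_eq_square algebra_simps)
    have "(\<Sum>i\<in>UNIV. (norm (A i))\<^sup>2) \<le> (\<Sum>i\<in>UNIV. 2 * c\<^sup>2 + 2 * (B\<^sup>2 * x) * (b $ i * b $ i))"
    proof (rule sum_mono)
      fix i
      have "(norm (A i))\<^sup>2 \<le> (norm (c *\<^sub>R axis i (1::real)) + norm ((B * b $ i) *\<^sub>R b))\<^sup>2"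
        unfolding A_def by (intro power_mono norm_triangle_ineq) auto
      also have "\<dots> \<le> 2 * (norm (c *\<^sub>R axis i (1::real)))\<^sup>2 + 2 * (norm ((B * b $ i) *\<^sub>R b))\<^sup>2"
        using sum_squares_bound[of "norm (c *\<^sub>R axis i (1::real))" "norm ((B * b $ i) *\<^sub>R b)"]
        by (simp add: power2_sum)
      also have "\<dots> = 2 * c\<^sup>2 + 2 * (B\<^sup>2 * x) * (b $ i * b $ i)"
        unfolding x_def power2_norm_eq_inner[symmetric]
        by (simp add: norm_axis_1 power_mult_distrib) (simp add: power2_eq_square)
      finally show "(norm (A i))\<^sup>2 \<le> 2 * c\<^sup>2 + 2 * (B\<^sup>2 * x) * (b $ i * b $ i)" .
    qed
    also have "\<dots> = 2 * (n * c\<^sup>2 + B\<^sup>2 * x\<^sup>2)"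
    proof -
      have "(\<Sum>i\<in>UNIV. 2 * (B\<^sup>2 * x) * (b $ i * b $ i)) = 2 * (B\<^sup>2 * x) * x"
        unfolding sum_distrib_left[symmetric] by (simp add: x_def inner_vec_def)
      then show ?thesis
        using assms by (simp only: sum.distrib sum_constant) (simp add: power2_eq_square)
    qed
    also have "\<dots> \<le> 2 * (n * (Cc * (1 + x))\<^sup>2 + CB\<^sup>2 * (1 + x)\<^sup>2)"
    proof -
      have "c\<^sup>2 \<le> (Cc * (1 + x))\<^sup>2" using c by (metis abs_ge_zero power2_abs power_mono)
      moreover have "B\<^sup>2 \<le> CB\<^sup>2" using B by (metis abs_ge_zero power2_abs power_mono)
      moreover have "x\<^sup>2 \<le> (1 + x)\<^sup>2" using x by (intro power_mono) auto
      ultimately show ?thesis using n by (intro mult_left_mono add_mono mult_mono) auto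
    qed
    also have "\<dots> = C / 4 * (1 + x)\<^sup>2" unfolding C_def power_mult_distrib by (simp add: algebra_simps)
    also have "\<dots> \<le> C / 4 * (2 * (1 + x\<^sup>2))" using 1 \<open>C > 0\<close> by (intro mult_left_mono) auto
    also have "\<dots> = C * (1 + x\<^sup>2) / 2" by simp
    finally have A: "2 * (\<Sum>i\<in>UNIV. (norm (A i))\<^sup>2) \<le> C * (1 + x\<^sup>2)" by linarith
    have "(\<Sum>i\<in>UNIV. V i \<bullet> V i) \<le> (\<Sum>i\<in>UNIV. 2 * (norm (V i - A i))\<^sup>2 + 2 * (norm (A i))\<^sup>2)"
    proof (rule sum_mono)
      fix i
      have "V i \<bullet> V i = (norm ((V i - A i) + A i))\<^sup>2" by (simp add: power2_norm_eq_inner)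
      also have "\<dots> \<le> (norm (V i - A i) + norm (A i))\<^sup>2"
        by (intro power_mono norm_triangle_ineq) auto
      also have "\<dots> \<le> 2 * (norm (V i - A i))\<^sup>2 + 2 * (norm (A i))\<^sup>2"
        using sum_squares_bound[of "norm (V i - A i)" "norm (A i)"] by (simp add: power2_sum)
      finally show "V i \<bullet> V i \<le> 2 * (norm (V i - A i))\<^sup>2 + 2 * (norm (A i))\<^sup>2" .
    qed
    also have "\<dots> = 2 * D + 2 * (\<Sum>i\<in>UNIV. (norm (A i))\<^sup>2)"
      by (simp add: D_def sum.distrib sum_distrib_left)
    also note A
    finally have V: "(\<Sum>i\<in>UNIV. V i \<bullet> V i) \<le> 2 * D + C * (1 + x\<^sup>2)" by simp
    have "D \<ge> 0" by (simp add: D_def sum_nonneg)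
    have "\<delta> * (1 + x\<^sup>2 + (\<Sum>i\<in>UNIV. V i \<bullet> V i)) \<le> \<delta> * (1 + x\<^sup>2 + (2 * D + C * (1 + x\<^sup>2)))"
      using V \<delta> by (intro mult_left_mono) auto
    also have "\<dots> = \<delta> * (1 + C) * (1 + x\<^sup>2) + \<delta> * (2 * D)" by (simp add: algebra_simps)
    also have "\<dots> \<le> d * (1 + x\<^sup>2) + 1 / 2 * (2 * D)"
      using \<delta> \<delta>C \<open>D \<ge> 0\<close> by (intro add_mono mult_right_mono) auto
    also have "\<dots> \<le> Q V b" using d(2)[OF x] by (simp add: QD)
    finally show ?thesis by (simp add: x_def)
  qed
  with \<delta>(1) show ?thesis by blast
qed

end

section \<open>The integral estimate\<close>

text \<open>With \<open>u = 1 - |x|\<^sup>2 / R\<^sup>2\<close> the left side is at most \<open>(2 J / R)\<^sup>K u\<^sup>J\<^sup>-\<^sup>K\<close>.\<close>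

lemma cutoff_ratio:
  fixes x :: "'a::euclidean_space" and K :: real
  assumes "R > 0" "J \<ge> 2" "real J \<ge> K" "K \<ge> 0" and pos: "cutoff R J x > 0"
  shows "cutoff R J x * (norm (cutoff_grad R J x) / cutoff R J x) powr K \<le> (2 * real J / R) powr K"
proof -
  define u where "u = max 0 (1 - (norm x)\<^sup>2 / R\<^sup>2)"
  have c: "cutoff R J x = u ^ J" by (simp add: cutoff_def u_def)
  have "u \<noteq> 0" using pos assms(2) by (auto simp: c power_0_left)
  moreover have "u \<ge> 0" unfolding u_def by (rule max.cobounded1)
  ultimately have u: "u > 0" by simp
  have "u \<le> 1" by (simp add: u_def)
  have "norm (cutoff_grad R J x) \<le> (2 * real J / R) * u ^ (J - 1)"
    using cutoff_grad_bound[OF assms(1,2), of x] by (simp add: u_def)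
  then have "norm (cutoff_grad R J x) / u ^ J \<le> (2 * real J / R) * u ^ (J - 1) / u ^ J"
    using u by (intro divide_right_mono) auto
  also have "\<dots> = (2 * real J / R) / u"
  proof -
    have "u ^ J = u * u ^ (J - 1)" using assms(2) by (cases J) auto
    then show ?thesis using u by simp
  qed
  finally have "(norm (cutoff_grad R J x) / u ^ J) powr K \<le> ((2 * real J / R) / u) powr K"
    using u assms by (intro powr_mono2) auto
  also have "\<dots> = (2 * real J / R) powr K * u powr (- K)"
  proof -
    define a where "a = 2 * real J / R"
    have "a \<ge> 0" using assms by (simp add: a_def)
    then show ?thesis
      unfolding a_def[symmetric] using u by (simp add: powr_divide powr_minus_divide)
  qed
  finally have "u ^ J * (norm (cutoff_grad R J x) / u ^ J) powr K
      \<le> u ^ J * ((2 * real J / R) powr K * u powr (- K))"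
    using u by (intro mult_left_mono) auto
  also have "\<dots> = (2 * real J / R) powr K * u powr (real J - K)"
    using u by (simp add: powr_realpow[symmetric] powr_diff powr_minus_divide)
  also have "\<dots> \<le> (2 * real J / R) powr K * 1"
    using u \<open>u \<le> 1\<close> assms by (intro mult_left_mono powr_le1) auto
  finally show ?thesis by (simp add: c)
qed

context exponents
begin

text \<open>This exponent turns the weight \<open>v\<^sup>\<kappa>\<^sup>+\<^sup>p\<close> into 1 when Young's inequality is applied to
\<open>v\<^sup>\<kappa>\<^sup>+\<^sup>p |\<nabla>\<eta>| v\<^sup>-\<^sup>(\<^sup>p\<^sup>-\<^sup>1\<^sup>)\<^sup>/\<^sup>2\<close>. That it exceeds the dimension is where the estimate beats the volume of balls.\<close>

definition "K = 2 * (\<kappa> + p) / (p - 1)"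

lemma K_ge: "K \<ge> n + 1"
proof -
  have "4 * p \<ge> (n + 2) * (p - 1)" using crit by (simp add: algebra_simps)
  then have "(n + 1) * ((n + 2) * (p - 1)) \<le> (n + 1) * (4 * p)"
    using n by (intro mult_left_mono) auto
  moreover have "K = (n + 1) * (4 * p) / ((n + 2) * (p - 1))"
    using n p by (simp add: K_def \<kappa>_def divide_simps) (simp add: algebra_simps)
  ultimately show ?thesis
    using n p by (simp add: le_divide_eq)
qed

text \<open>With \<open>W = 1 + x\<^sup>2 + |V|\<^sup>2\<close>, the vector \<open>b\<close> is of order \<open>W\<close> to the power 1/4, and \<open>V\<close>, \<open>F(x)\<close> and \<open>h(x)\<close>
are of order \<open>W\<close> to the power 1/2.\<close>

lemma flux_bound:
  assumes "n = real CARD('n::finite)"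
  shows "\<exists>C>0. \<forall>(V :: 'n \<Rightarrow> real ^ 'n) b e.
     \<bar>e \<bullet> ((\<chi> i. V i \<bullet> b) + F (b \<bullet> b) *\<^sub>R b + h (b \<bullet> b) *\<^sub>R b)\<bar>
       \<le> C * norm e * (1 + (b \<bullet> b)\<^sup>2 + (\<Sum>i\<in>UNIV. V i \<bullet> V i)) powr (3 / 4)"
proof -
  obtain Ch where Ch: "Ch > 0" "\<And>x. x \<ge> 0 \<Longrightarrow> \<bar>h x\<bar> \<le> Ch * (1 + x)"
    using h_linear_bound by blast
  define C where "C = 1 + 2 * (1 + M + Ch)"
  have "C > 0" using Ch(1) M by (simp add: C_def add_pos_pos)
  moreover have "\<bar>e \<bullet> ((\<chi> i. V i \<bullet> b) + F (b \<bullet> b) *\<^sub>R b + h (b \<bullet> b) *\<^sub>R b)\<bar>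
       \<le> C * norm e * (1 + (b \<bullet> b)\<^sup>2 + (\<Sum>i\<in>UNIV. V i \<bullet> V i)) powr (3 / 4)"
    for V :: "'n \<Rightarrow> real ^ 'n" and b e
  proof -
    define x where "x = b \<bullet> b"
    define N where "N = (\<Sum>i\<in>UNIV. V i \<bullet> V i)"
    define t where "t = (1 + x\<^sup>2 + N) powr (1 / 4)"
    have x: "x \<ge> 0" by (simp add: x_def)
    have N: "N \<ge> 0" by (simp add: N_def sum_nonneg)
    have W: "1 + x\<^sup>2 + N \<ge> 1" using N by simp
    have t: "t \<ge> 1" unfolding t_def using W by (intro ge_one_powr_ge_zero) auto
    have t4: "t ^ 4 = 1 + x\<^sup>2 + N" and t3: "t ^ 3 = (1 + x\<^sup>2 + N) powr (3 / 4)"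
      unfolding t_def using W by (auto simp: powr_powr simp flip: powr_numeral)
    have t22: "(t\<^sup>2)\<^sup>2 = t ^ 4" by simp
    have xt: "x \<le> t\<^sup>2"
      by (rule power2_le_imp_le) (use N t in \<open>auto simp: t22 t4\<close>)
    have b: "norm b \<le> t"
      by (rule power2_le_imp_le) (use xt t in \<open>auto simp: power2_norm_eq_inner x_def\<close>)
    have "norm (\<chi> i. V i \<bullet> b) \<le> t\<^sup>2 * norm b"
    proof (rule power2_le_imp_le)
      have "(norm (\<chi> i. V i \<bullet> b))\<^sup>2 = (\<Sum>i\<in>UNIV. (V i \<bullet> b)\<^sup>2)"
        by (simp add: norm_vec_def L2_set_def sum_nonneg)
      also have "\<dots> \<le> (\<Sum>i\<in>UNIV. (V i \<bullet> V i) * (b \<bullet> b))"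
        by (intro sum_mono Cauchy_Schwarz_ineq)
      also have "\<dots> = N * (b \<bullet> b)" by (simp add: N_def sum_distrib_right)
      also have "\<dots> \<le> t ^ 4 * (b \<bullet> b)" using t4 N by (intro mult_right_mono) auto
      also have "\<dots> = (t\<^sup>2 * norm b)\<^sup>2" by (simp add: power_mult_distrib power2_norm_eq_inner)
      finally show "(norm (\<chi> i. V i \<bullet> b))\<^sup>2 \<le> (t\<^sup>2 * norm b)\<^sup>2" .
    qed simp
    moreover have "norm (F x *\<^sub>R b + h x *\<^sub>R b) \<le> ((1 + M + Ch) * (2 * t\<^sup>2)) * norm b"
    proof -
      have "1 + x \<le> 2 * t\<^sup>2" using xt one_le_power[OF t, of 2] by linarith
      have "\<bar>F x + h x\<bar> \<le> (1 + M) * (1 + x) + Ch * (1 + x)"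
        using F_linear_bound[OF x] F_ge_1[of x] Ch(2)[OF x] by linarith
      also have "\<dots> = (1 + M + Ch) * (1 + x)" by (simp add: algebra_simps)
      also have "\<dots> \<le> (1 + M + Ch) * (2 * t\<^sup>2)"
        using \<open>1 + x \<le> 2 * t\<^sup>2\<close> M Ch(1) by (intro mult_left_mono) auto
      finally have "\<bar>F x + h x\<bar> * norm b \<le> ((1 + M + Ch) * (2 * t\<^sup>2)) * norm b"
        by (intro mult_right_mono) auto
      then show ?thesis by (simp flip: scaleR_add_left)
    qed
    ultimately have "norm ((\<chi> i. V i \<bullet> b) + (F x *\<^sub>R b + h x *\<^sub>R b))
        \<le> t\<^sup>2 * norm b + ((1 + M + Ch) * (2 * t\<^sup>2)) * norm b"
      by (rule norm_triangle_mono)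
    also have "\<dots> = C * t\<^sup>2 * norm b" by (simp add: C_def algebra_simps)
    also have "\<dots> \<le> C * t\<^sup>2 * t" using b \<open>C > 0\<close> by (intro mult_left_mono) auto
    also have "\<dots> = C * t ^ 3" by (simp add: numeral_eq_Suc)
    finally have "norm ((\<chi> i. V i \<bullet> b) + (F x *\<^sub>R b + h x *\<^sub>R b)) \<le> C * t ^ 3" .
    then have "norm e * norm ((\<chi> i. V i \<bullet> b) + (F x *\<^sub>R b + h x *\<^sub>R b)) \<le> norm e * (C * t ^ 3)"
      by (intro mult_left_mono) auto
    then show ?thesis
      using order_trans[OF Cauchy_Schwarz_ineq2[of e "(\<chi> i. V i \<bullet> b) + (F x *\<^sub>R b + h x *\<^sub>R b)"]]
      unfolding t3 by (simp add: x_def N_def add.assoc algebra_simps)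
  qed
  ultimately show ?thesis by blast
qed

text \<open>The pointwise content of the two integral identities. Here \<open>A\<close>, \<open>P\<close> and \<open>z\<close> stand for the powers of \<open>v\<close>
with exponents \<open>\<kappa> - p\<close>, \<open>p\<close> and \<open>(p + 1) / 2\<close>, \<open>\<eta>\<close> for the cutoff function and \<open>e\<close> for its gradient;
\<open>w1\<close>, \<open>w2\<close> and \<open>x'\<close> are the gradients of the two test functions and of \<open>|\<nabla>v|\<^sup>2 / v\<^sup>p\<^sup>+\<^sup>1\<close>.\<close>

lemma integrand_eq:
  fixes V :: "'n::finite \<Rightarrow> real ^ 'n" and b e :: "real ^ 'n"
    and v A P z \<eta> :: real
  assumes v: "v > 0" and z: "z > 0" and z2: "z\<^sup>2 = v * P"
    and trace: "(\<Sum>i\<in>UNIV. V i $ i) = - F (b \<bullet> b)"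
  defines "G \<equiv> z *\<^sub>R b" and "H \<equiv> \<lambda>i. P *\<^sub>R V i"
  defines "w1 \<equiv> A *\<^sub>R e + \<eta> *\<^sub>R (((\<kappa> - p) * (A / v)) *\<^sub>R G)"
  defines "x' \<equiv> (1 / z\<^sup>2) *\<^sub>R (\<Sum>i\<in>UNIV. (2 * G $ i) *\<^sub>R H i) + (G \<bullet> G) *\<^sub>R ((- (p + 1) / (z\<^sup>2 * v)) *\<^sub>R G)"
  defines "w2 \<equiv> (A * P) *\<^sub>R (h (b \<bullet> b) *\<^sub>R e + \<eta> *\<^sub>R (h' (b \<bullet> b) *\<^sub>R x'))
      + (h (b \<bullet> b) * \<eta>) *\<^sub>R ((\<kappa> * (A * P / v)) *\<^sub>R G)"
  shows "(A * \<eta>) * ((\<Sum>i\<in>UNIV. H i \<bullet> H i) - (\<Sum>i\<in>UNIV. H i $ i)\<^sup>2)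
       + w1 \<bullet> (\<chi> i. H i \<bullet> G) - (w1 \<bullet> G) * (\<Sum>i\<in>UNIV. H i $ i)
       + ((A * P) * (h (b \<bullet> b) * \<eta>) * (\<Sum>i\<in>UNIV. H i $ i) + w2 \<bullet> G)
     = A * P\<^sup>2 * \<eta> * Q V b
       + A * P * z * (e \<bullet> ((\<chi> i. V i \<bullet> b) + F (b \<bullet> b) *\<^sub>R b + h (b \<bullet> b) *\<^sub>R b))"
proof -
  define x where "x = b \<bullet> b"
  define y where "y = (\<chi> i. V i \<bullet> b)"
  define X where "X = b \<bullet> y"
  define N where "N = (\<Sum>i\<in>UNIV. V i \<bullet> V i)"
  have P: "P = z\<^sup>2 / v" using z2 v by (simp add: field_simps)
  have HH: "(\<Sum>i\<in>UNIV. H i \<bullet> H i) = P\<^sup>2 * N"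
    by (simp add: H_def N_def sum_distrib_left power2_eq_square mult.assoc)
  have tr: "(\<Sum>i\<in>UNIV. H i $ i) = - (P * F x)"
    using trace by (simp add: H_def x_def flip: sum_distrib_left)
  have HG: "(\<chi> i. H i \<bullet> G) = (P * z) *\<^sub>R y"
    by (simp add: H_def G_def y_def vec_eq_iff)
  have GG: "G \<bullet> G = z\<^sup>2 * x" by (simp add: G_def x_def power2_eq_square)
  have "(\<Sum>i\<in>UNIV. (2 * G $ i) *\<^sub>R H i) \<bullet> G = (\<Sum>i\<in>UNIV. 2 * P * z\<^sup>2 * (b $ i * (V i \<bullet> b)))"
    by (simp add: inner_sum_left G_def H_def power2_eq_square sum_distrib_left algebra_simps)
  also have "\<dots> = 2 * P * z\<^sup>2 * X"
    unfolding sum_distrib_left[symmetric] by (simp add: X_def y_def inner_vec_def)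
  finally have S: "(\<Sum>i\<in>UNIV. (2 * G $ i) *\<^sub>R H i) \<bullet> G = 2 * P * z\<^sup>2 * X" .
  have Gy: "G \<bullet> y = z * X" by (simp add: G_def X_def)
  have eG: "e \<bullet> G = z * (e \<bullet> b)" by (simp add: G_def)
  have x'G: "x' \<bullet> G = P * (2 * X - (p + 1) * x\<^sup>2)"
  proof -
    have "x' \<bullet> G = 1 / z\<^sup>2 * (2 * P * z\<^sup>2 * X) - (p + 1) * (z\<^sup>2 * x)\<^sup>2 / (z\<^sup>2 * v)"
      by (simp only: x'_def inner_add_left inner_scaleR_left S GG) (use z v in \<open>simp add: power2_eq_square field_simps\<close>)
    also have "1 / z\<^sup>2 * (2 * P * z\<^sup>2 * X) = P * (2 * X)" using z by simp
    also have "(p + 1) * (z\<^sup>2 * x)\<^sup>2 / (z\<^sup>2 * v) = P * ((p + 1) * x\<^sup>2)"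
      unfolding P using z v by (simp add: power2_eq_square)
    finally show ?thesis by (simp add: algebra_simps)
  qed
  have w1y: "w1 \<bullet> ((P * z) *\<^sub>R y) = A * P * z * (e \<bullet> y) + (\<kappa> - p) * A * \<eta> * P\<^sup>2 * X"
  proof -
    have "w1 \<bullet> ((P * z) *\<^sub>R y) = A * P * z * (e \<bullet> y) + (\<kappa> - p) * A * \<eta> * P * X * (z\<^sup>2 / v)"
      by (simp add: w1_def inner_add_left Gy power2_eq_square algebra_simps)
    then show ?thesis unfolding P[symmetric] by (simp add: power2_eq_square)
  qed
  have w1G: "w1 \<bullet> G = A * z * (e \<bullet> b) + (\<kappa> - p) * A * \<eta> * P * x"
  proof -
    have "w1 \<bullet> G = A * z * (e \<bullet> b) + (\<kappa> - p) * A * \<eta> * x * (z\<^sup>2 / v)"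
      by (simp add: w1_def inner_add_left eG GG algebra_simps)
    then show ?thesis unfolding P[symmetric] by simp
  qed
  have w2G: "w2 \<bullet> G = A * P * z * h x * (e \<bullet> b) + A * P\<^sup>2 * \<eta> * h' x * (2 * X - (p + 1) * x\<^sup>2)
      + \<kappa> * A * P\<^sup>2 * \<eta> * h x * x"
  proof -
    have "w2 \<bullet> G = A * P * (h x * (z * (e \<bullet> b)) + \<eta> * (h' x * (P * (2 * X - (p + 1) * x\<^sup>2))))
        + h x * \<eta> * (\<kappa> * A * P * x * (z\<^sup>2 / v))"
      by (simp only: w2_def inner_add_left inner_scaleR_left x'G GG eG x_def[symmetric]) simp
    then show ?thesis unfolding P[symmetric] by (simp add: power2_eq_square algebra_simps)
  qed
  have Q: "Q V b = N - (F x)\<^sup>2 + (\<kappa> - p) * (X + x * F x)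
     + (\<kappa> * x - F x) * h x + h' x * (2 * X - (p + 1) * x\<^sup>2)"
    by (simp add: Q_def Let_def x_def X_def y_def N_def)
  show ?thesis
    unfolding HG HH tr x_def[symmetric] y_def[symmetric] w1y w1G w2G Q
    by (simp add: inner_add_right algebra_simps power2_eq_square)
qed

lemma pointwise_lower_bound:
  assumes dim: "n = real CARD('n::finite)"
  shows "\<exists>c>0. \<exists>C>0. \<forall>(V :: 'n \<Rightarrow> real ^ 'n) b e v \<eta>. v > 0 \<longrightarrow> \<eta> > 0 \<longrightarrow>
     (\<Sum>i\<in>UNIV. V i $ i) = - F (b \<bullet> b) \<longrightarrow>
     v powr (\<kappa> + p) * \<eta> * Q V b + v powr (\<kappa> + p + (1 - p) / 2)
         * (e \<bullet> ((\<chi> i. V i \<bullet> b) + F (b \<bullet> b) *\<^sub>R b + h (b \<bullet> b) *\<^sub>R b))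
       \<ge> c * (v powr (\<kappa> + p) * \<eta>) - C * (\<eta> * (norm e / \<eta>) powr K)"
proof -
  obtain \<delta> where \<delta>: "\<delta> > 0" "\<And>(V :: 'n \<Rightarrow> real ^ 'n) b. (\<Sum>i\<in>UNIV. V i $ i) = - F (b \<bullet> b) \<Longrightarrow>
      Q V b \<ge> \<delta> * (1 + (b \<bullet> b)\<^sup>2 + (\<Sum>i\<in>UNIV. V i \<bullet> V i))"
    using Q_coercive[OF dim] by blast
  obtain C where C: "C > 0" "\<And>(V :: 'n \<Rightarrow> real ^ 'n) b e.
     \<bar>e \<bullet> ((\<chi> i. V i \<bullet> b) + F (b \<bullet> b) *\<^sub>R b + h (b \<bullet> b) *\<^sub>R b)\<bar>
       \<le> C * norm e * (1 + (b \<bullet> b)\<^sup>2 + (\<Sum>i\<in>UNIV. V i \<bullet> V i)) powr (3 / 4)"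
    using flux_bound[OF dim] by blast
  have K4: "K \<ge> 4" using K_ge n by simp
  define c where "c = \<delta> / 2"
  define C' where "C' = \<delta> / 2 * (2 * C / \<delta>) powr K"
  have "C' > 0" "c > 0" using \<delta>(1) C(1) by (simp_all add: C'_def c_def)
  moreover have "v powr (\<kappa> + p) * \<eta> * Q V b + v powr (\<kappa> + p + (1 - p) / 2)
         * (e \<bullet> ((\<chi> i. V i \<bullet> b) + F (b \<bullet> b) *\<^sub>R b + h (b \<bullet> b) *\<^sub>R b))
       \<ge> c * (v powr (\<kappa> + p) * \<eta>) - C' * (\<eta> * (norm e / \<eta>) powr K)"
    if v: "v > 0" and \<eta>: "\<eta> > 0" and tr: "(\<Sum>i\<in>UNIV. V i $ i) = - F (b \<bullet> b)"
    for V :: "'n \<Rightarrow> real ^ 'n" and b e v \<eta>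
  proof -
    define W where "W = 1 + (b \<bullet> b)\<^sup>2 + (\<Sum>i\<in>UNIV. V i \<bullet> V i)"
    define flux where "flux = e \<bullet> ((\<chi> i. V i \<bullet> b) + F (b \<bullet> b) *\<^sub>R b + h (b \<bullet> b) *\<^sub>R b)"
    define l where "l = norm e * v powr ((1 - p) / 2)"
    have W1: "W \<ge> 1" by (simp add: W_def sum_nonneg)
    have scale: "v powr (\<kappa> + p + (1 - p) / 2) = v powr (\<kappa> + p) * v powr ((1 - p) / 2)"
      by (rule powr_add)
    have "(1 - p) / 2 * K = - ((p - 1) * K / 2)" by (simp add: field_simps)
    also have "(p - 1) * K = 2 * (\<kappa> + p)" using p by (simp add: K_def)
    also have "- (2 * (\<kappa> + p) / 2) = - (\<kappa> + p)"
      by (subst nonzero_mult_div_cancel_left) simp_all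
    finally have "(1 - p) / 2 * K = - (\<kappa> + p)" .
    then have "(v powr ((1 - p) / 2)) powr K = v powr (- (\<kappa> + p))"
      by (simp only: powr_powr)
    moreover have "v powr (\<kappa> + p) * v powr (- (\<kappa> + p)) = 1"
      by (subst powr_minus) (use v in simp)
    moreover have "l / \<eta> = norm e / \<eta> * v powr ((1 - p) / 2)" by (simp add: l_def)
    ultimately have lK: "v powr (\<kappa> + p) * (l / \<eta>) powr K = (norm e / \<eta>) powr K"
    proof -
      assume a: "(v powr ((1 - p) / 2)) powr K = v powr (- (\<kappa> + p))"
        and b: "v powr (\<kappa> + p) * v powr (- (\<kappa> + p)) = 1"
        and c: "l / \<eta> = norm e / \<eta> * v powr ((1 - p) / 2)"
      have "v powr (\<kappa> + p) * (l / \<eta>) powr K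
          = (norm e / \<eta>) powr K * (v powr (\<kappa> + p) * v powr (- (\<kappa> + p)))"
        unfolding c powr_mult a by (rule mult.left_commute)
      then show ?thesis unfolding b by simp
    qed
    have "v powr (\<kappa> + p) * (c * \<eta> - C' * (\<eta> * (l / \<eta>) powr K))
        \<le> v powr (\<kappa> + p) * (\<delta> * \<eta> * W - C * l * W powr (3 / 4))"
      using young_quarter[OF \<delta>(1) C(1) W1 \<eta> _ K4, of l]
      by (intro mult_left_mono) (simp_all add: c_def C'_def l_def)
    also have "\<dots> \<le> v powr (\<kappa> + p) * \<eta> * Q V b + v powr (\<kappa> + p + (1 - p) / 2) * flux"
    proof -
      have 1: "\<eta> * (\<delta> * W) \<le> \<eta> * Q V b"
        using \<delta>(2)[OF tr] \<eta> by (intro mult_left_mono) (auto simp: W_def)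
      have "- (C * norm e * W powr (3 / 4)) \<le> flux"
        using C(2)[of e V b] by (simp add: W_def flux_def)
      then have "v powr ((1 - p) / 2) * - (C * norm e * W powr (3 / 4)) \<le> v powr ((1 - p) / 2) * flux"
        by (intro mult_left_mono) auto
      then have 2: "- (C * l * W powr (3 / 4)) \<le> v powr ((1 - p) / 2) * flux"
        by (simp add: l_def algebra_simps)
      have "v powr (\<kappa> + p) * (\<delta> * \<eta> * W - C * l * W powr (3 / 4))
          \<le> v powr (\<kappa> + p) * (\<eta> * Q V b + v powr ((1 - p) / 2) * flux)"
        using 1 2 by (intro mult_left_mono) (simp_all add: algebra_simps)
      then show ?thesis unfolding scale by (simp add: algebra_simps)
    qed
    also have "v powr (\<kappa> + p) * (c * \<eta> - C' * (\<eta> * (l / \<eta>) powr K))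
       = c * (v powr (\<kappa> + p) * \<eta>) - C' * (\<eta> * (v powr (\<kappa> + p) * (l / \<eta>) powr K))"
      by (simp add: algebra_simps)
    finally show ?thesis unfolding lK flux_def .
  qed
  ultimately show ?thesis by blast
qed

text \<open>The sum of the integrands of \<open>weak_bochner\<close> and \<open>weak_laplacian\<close> for the test functions \<open>w1\<close> and \<open>w2\<close> has
integral zero and is bounded below by \<open>pointwise_lower_bound\<close>.\<close>

lemma energy_estimate:
  fixes v :: "real ^ 'n::finite \<Rightarrow> real"
  assumes dim: "n = real CARD('n)"
    and v: "has_cont_grad v G" and H: "\<And>i. has_cont_grad (\<lambda>x. G x $ i) (H i)"
    and pos: "\<And>x. v x > 0"
    and eq: "\<And>x. (\<Sum>i\<in>UNIV. H i x $ i) = - (v x powr p + M * norm (G x) powr (2 * s))"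
  shows "\<exists>C. \<forall>R J. R > 0 \<longrightarrow> real J \<ge> K \<longrightarrow>
    (\<integral>x. cutoff R J x * v x powr (\<kappa> + p) \<partial>lborel)
      \<le> C * (2 * real J / R) powr K * measure lborel (cball (0::real ^ 'n) R)"
proof -
  obtain c C where c: "c > 0" and C: "C > 0" and lower:
    "\<And>(V :: 'n \<Rightarrow> real ^ 'n) b e v \<eta>. v > 0 \<Longrightarrow> \<eta> > 0 \<Longrightarrow>
     (\<Sum>i\<in>UNIV. V i $ i) = - F (b \<bullet> b) \<Longrightarrow>
     v powr (\<kappa> + p) * \<eta> * Q V b + v powr (\<kappa> + p + (1 - p) / 2)
         * (e \<bullet> ((\<chi> i. V i \<bullet> b) + F (b \<bullet> b) *\<^sub>R b + h (b \<bullet> b) *\<^sub>R b))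
       \<ge> c * (v powr (\<kappa> + p) * \<eta>) - C * (\<eta> * (norm e / \<eta>) powr K)"
    using pointwise_lower_bound[OF dim] by blast
  have powr_grad: "has_cont_grad (\<lambda>x. v x powr r) (\<lambda>x. (r * v x powr (r - 1)) *\<^sub>R G x)" for r
  proof (rule has_cont_grad_compose[OF v])
    show "((\<lambda>t. t powr r) has_real_derivative r * v x powr (r - 1)) (at (v x))" for x
      using pos by (rule has_real_derivative_powr)
    have nz: "t \<noteq> 0" if t: "t \<in> range v" for t
    proof -
      obtain x where "t = v x" using t by blast
      then show ?thesis using pos[of x] by simp
    qed
    show "continuous_on (range v) (\<lambda>t. r * t powr (r - 1))"
      by (intro continuous_on_mult continuous_on_const continuous_on_powr continuous_on_id ballI nz)
  qed
  define xh where "xh = (\<lambda>x. v x powr (- (p + 1)) * (G x \<bullet> G x))"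
  define xh' where "xh' = (\<lambda>x. v x powr (- (p + 1)) *\<^sub>R (\<Sum>i\<in>UNIV. (2 * G x $ i) *\<^sub>R H i x)
      + (G x \<bullet> G x) *\<^sub>R ((- (p + 1) * v x powr (- (p + 1) - 1)) *\<^sub>R G x))"
  have "has_cont_grad (\<lambda>x. \<Sum>i\<in>UNIV. G x $ i * G x $ i) (\<lambda>x. \<Sum>i\<in>UNIV. G x $ i *\<^sub>R H i x + G x $ i *\<^sub>R H i x)"
    by (intro has_cont_grad_sum has_cont_grad_mult H)
  then have GG: "has_cont_grad (\<lambda>x. G x \<bullet> G x) (\<lambda>x. \<Sum>i\<in>UNIV. (2 * G x $ i) *\<^sub>R H i x)"
    by (simp only: inner_vec_def inner_real_def mult_2 scaleR_add_left)
  have xh: "has_cont_grad xh xh'"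
    unfolding xh_def xh'_def by (rule has_cont_grad_mult[OF powr_grad GG])
  have xh_nonneg: "xh x \<ge> 0" for x by (simp add: xh_def)
  have hxh: "has_cont_grad (\<lambda>x. h (xh x)) (\<lambda>x. h' (xh x) *\<^sub>R xh' x)"
  proof (rule has_cont_grad_compose[OF xh h_has_derivative[OF xh_nonneg]])
    have "\<forall>t\<in>range xh. (1 + t)\<^sup>2 \<noteq> 0"
    proof
      fix t assume "t \<in> range xh"
      then have "t \<ge> 0" using xh_nonneg by auto
      then show "(1 + t)\<^sup>2 \<noteq> 0" by simp
    qed
    then show "continuous_on (range xh) h'"
      unfolding h'_def \<theta>'_def by (intro continuous_intros) simp_all
  qed
  have "c * (\<integral>x. cutoff R J x * v x powr (\<kappa> + p) \<partial>lborel)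
      \<le> C * (2 * real J / R) powr K * measure lborel (cball (0::real ^ 'n) R)"
    if R: "R > 0" and JK: "real J \<ge> K" for R J
  proof -
    have J: "J \<ge> 2" using JK K_ge n by linarith
    define \<eta> where "\<eta> = (cutoff R J :: real ^ 'n \<Rightarrow> real)"
    define \<eta>' where "\<eta>' = (cutoff_grad R J :: real ^ 'n \<Rightarrow> _)"
    have \<eta>: "has_cont_grad \<eta> \<eta>'" unfolding \<eta>_def \<eta>'_def by (rule has_cont_grad_cutoff[OF J])
    have supp: "\<eta> x = 0" if "norm x > R" for x
      using that R J by (simp add: \<eta>_def cutoff_eq_0)
    define w1 where "w1 = (\<lambda>x. v x powr (\<kappa> - p) * \<eta> x)"
    define w1' where "w1' = (\<lambda>x. v x powr (\<kappa> - p) *\<^sub>R \<eta>' x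
        + \<eta> x *\<^sub>R (((\<kappa> - p) * v x powr (\<kappa> - p - 1)) *\<^sub>R G x))"
    have w1: "has_cont_grad w1 w1'"
      unfolding w1_def w1'_def by (rule has_cont_grad_mult[OF powr_grad \<eta>])
    define w2 where "w2 = (\<lambda>x. v x powr \<kappa> * (h (xh x) * \<eta> x))"
    define w2' where "w2' = (\<lambda>x. v x powr \<kappa> *\<^sub>R (h (xh x) *\<^sub>R \<eta>' x + \<eta> x *\<^sub>R (h' (xh x) *\<^sub>R xh' x))
        + (h (xh x) * \<eta> x) *\<^sub>R ((\<kappa> * v x powr (\<kappa> - 1)) *\<^sub>R G x))"
    have w2: "has_cont_grad w2 w2'"
      unfolding w2_def w2'_def by (rule has_cont_grad_mult[OF powr_grad has_cont_grad_mult[OF hxh \<eta>]])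
    have supp1: "w1 x = 0" and supp2: "w2 x = 0" if "norm x > R" for x
      using supp[OF that] by (simp_all add: w1_def w2_def)
    note supp1' = grad_eq_0_outside_support[OF w1 supp1]
    note supp2' = grad_eq_0_outside_support[OF w2 supp2]
    define I1 where "I1 = (\<lambda>x. w1 x * ((\<Sum>i\<in>UNIV. H i x \<bullet> H i x) - (\<Sum>i\<in>UNIV. H i x $ i)\<^sup>2)
            + w1' x \<bullet> (\<chi> i. H i x \<bullet> G x) - (w1' x \<bullet> G x) * (\<Sum>i\<in>UNIV. H i x $ i))"
    define I2 where "I2 = (\<lambda>x. w2 x * (\<Sum>i\<in>UNIV. H i x $ i) + w2' x \<bullet> G x)"
    have cG: "continuous_on UNIV G"
    proof -
      have "continuous_on UNIV (\<lambda>x. \<chi> i. G x $ i)"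
        by (intro continuous_on_vec_lambda has_cont_gradD[OF H])
      then show ?thesis by simp
    qed
    have int1: "integrable lborel I1"
    proof (rule integrable_compact_support[where R = R])
      show "continuous_on UNIV I1"
        unfolding I1_def
        by (intro continuous_intros continuous_on_vec_lambda cG has_cont_gradD[OF H] has_cont_gradD[OF w1])
    qed (simp add: I1_def supp1 supp1')
    have int2: "integrable lborel I2"
    proof (rule integrable_compact_support[where R = R])
      show "continuous_on UNIV I2"
        unfolding I2_def
        by (intro continuous_intros cG has_cont_gradD[OF H] has_cont_gradD[OF w2])
    qed (simp add: I2_def supp2 supp2')
    have "(\<integral>x. I1 x \<partial>lborel) = 0"
      unfolding I1_def by (rule weak_bochner[OF v H w1 supp1])
    moreover have "(\<integral>x. I2 x \<partial>lborel) = 0"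
      unfolding I2_def by (rule weak_laplacian[OF v H w2 supp2])
    ultimately have zero: "(\<integral>x. I1 x + I2 x \<partial>lborel) = 0"
      using int1 int2 by simp
    have below: "c * (cutoff R J x * v x powr (\<kappa> + p))
        - indicator (cball 0 R) x * (C * (2 * real J / R) powr K) \<le> I1 x + I2 x" for x
    proof -
      have vx: "v x > 0" by (rule pos)
      define P where "P = v x powr p"
      define A where "A = v x powr (\<kappa> - p)"
      define z where "z = v x powr ((p + 1) / 2)"
      \<comment> \<open>Scaling out \<open>v\<close> at the point \<open>x\<close> reduces the integrand to the algebra of \<open>integrand_eq\<close>.\<close>
      define b where "b = (1 / z) *\<^sub>R G x"
      define V where "V = (\<lambda>i. (1 / P) *\<^sub>R H i x)"
      have Pz: "P > 0" "z > 0" using vx by (auto simp: P_def z_def)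
      have z2': "z\<^sup>2 = v x powr (p + 1)"
        using vx by (simp add: z_def power2_eq_square flip: powr_add)
      then have z2: "z\<^sup>2 = v x * P"
        using vx by (simp add: P_def powr_add)
      have Gb: "G x = z *\<^sub>R b" and HV: "(\<lambda>i. H i x) = (\<lambda>i. P *\<^sub>R V i)"
        using Pz by (auto simp: b_def V_def)
      have bb: "b \<bullet> b = xh x"
      proof -
        have "b \<bullet> b = (G x \<bullet> G x) / z\<^sup>2" by (simp add: b_def power2_eq_square)
        then show ?thesis unfolding z2' xh_def by (simp only: powr_minus divide_inverse mult.commute)
      qed
      have tr: "(\<Sum>i\<in>UNIV. V i $ i) = - F (b \<bullet> b)"
      proof -
        have "norm (G x) powr (2 * s) = (norm (G x) powr 2) powr s"
          by (rule powr_powr[symmetric])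
        also have "norm (G x) powr 2 = (norm (G x))\<^sup>2" by (cases "G x = 0") auto
        also have "\<dots> = z\<^sup>2 * (b \<bullet> b)"
          by (simp add: Gb power_mult_distrib power2_norm_eq_inner)
        also have "(z\<^sup>2 * (b \<bullet> b)) powr s = (z\<^sup>2) powr s * (b \<bullet> b) powr s"
          by (rule powr_mult; simp)
        also have "(z\<^sup>2) powr s = P"
          using p by (simp add: z2' P_def powr_powr s_def)
        finally have "v x powr p + M * norm (G x) powr (2 * s) = P * F (b \<bullet> b)"
          by (simp add: P_def[symmetric] F_def algebra_simps)
        moreover have "(\<Sum>i\<in>UNIV. V i $ i) = (1 / P) * (\<Sum>i\<in>UNIV. H i x $ i)"
          by (simp add: V_def sum_distrib_left)
        ultimately show ?thesis using eq[of x] Pz by simp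
      qed
      have AP: "v x powr \<kappa> = A * P"
        by (simp add: A_def P_def flip: powr_add)
      have AP2: "A * P\<^sup>2 = v x powr (\<kappa> + p)"
        by (simp add: A_def P_def power2_eq_square add.commute flip: powr_add)
      have "A * P * z = v x powr (\<kappa> - p + p + (p + 1) / 2)"
        by (simp only: A_def P_def z_def powr_add)
      also have "\<kappa> - p + p + (p + 1) / 2 = \<kappa> + p + (1 - p) / 2"
        by (simp add: field_simps)
      finally have APz: "A * P * z = v x powr (\<kappa> + p + (1 - p) / 2)" .
      have Av: "v x powr (\<kappa> - p - 1) = A / v x" "v x powr (\<kappa> - 1) = A * P / v x"
        using vx powr_diff[of "v x" "\<kappa> - p" 1] powr_diff[of "v x" \<kappa> 1]
        by (simp_all only: AP A_def[symmetric] powr_one)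
      have zv: "v x powr (- (p + 1)) = 1 / z\<^sup>2" "v x powr (- (p + 1) - 1) = 1 / (z\<^sup>2 * v x)"
        unfolding z2' powr_diff powr_minus_divide using vx by simp_all
      have "I1 x + I2 x = A * P\<^sup>2 * \<eta> x * Q V b
       + A * P * z * (\<eta>' x \<bullet> ((\<chi> i. V i \<bullet> b) + F (b \<bullet> b) *\<^sub>R b + h (b \<bullet> b) *\<^sub>R b))"
        using integrand_eq[OF vx Pz(2) z2 tr, of A "\<eta> x" "\<eta>' x", folded Gb, unfolded fun_cong[OF HV, symmetric]]
        unfolding I1_def I2_def w1_def w2_def w1'_def w2'_def xh'_def bb Av zv AP A_def[symmetric]
        by (simp add: mult.assoc)
      then have I: "I1 x + I2 x = v x powr (\<kappa> + p) * \<eta> x * Q V b + v x powr (\<kappa> + p + (1 - p) / 2)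
         * (\<eta>' x \<bullet> ((\<chi> i. V i \<bullet> b) + F (b \<bullet> b) *\<^sub>R b + h (b \<bullet> b) *\<^sub>R b))"
        unfolding AP2 APz .
      show ?thesis
      proof (cases "\<eta> x > 0")
        case True
        then have "norm x \<le> R" using supp[of x] by force
        have "\<eta> x * (norm (\<eta>' x) / \<eta> x) powr K \<le> (2 * real J / R) powr K"
          unfolding \<eta>_def \<eta>'_def
          by (rule cutoff_ratio) (use R J JK K_ge n True in \<open>auto simp: \<eta>_def\<close>)
        then have "C * (\<eta> x * (norm (\<eta>' x) / \<eta> x) powr K) \<le> C * (2 * real J / R) powr K"
          using C by simp
        with lower[OF vx True tr, of "\<eta>' x"] show ?thesis
          using \<open>norm x \<le> R\<close> unfolding I by (simp add: \<eta>_def mult.commute)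
      next
        case False
        then have 0: "\<eta> x = 0" using cutoff_nonneg[of R J x] by (simp add: \<eta>_def)
        \<comment> \<open>The cutoff function vanishes to second order at the boundary of its support.\<close>
        then have "\<eta>' x = 0" using J by (auto simp: \<eta>_def \<eta>'_def cutoff_def cutoff_grad_def)
        with 0 have "I1 x + I2 x = 0" unfolding I by simp
        moreover have "cutoff R J x = 0" using 0 by (simp add: \<eta>_def)
        ultimately show ?thesis using C by simp
      qed
    qed
    have intL: "integrable lborel (\<lambda>x. cutoff R J x * v x powr (\<kappa> + p))"
    proof (rule integrable_compact_support[where R = R])
      show "continuous_on UNIV (\<lambda>x. cutoff R J x * v x powr (\<kappa> + p))"
        using has_cont_gradD(3)[OF \<eta>] has_cont_gradD(3)[OF powr_grad]
        by (intro continuous_on_mult) (auto simp: \<eta>_def)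
    qed (use supp in \<open>simp add: \<eta>_def\<close>)
    have intR: "integrable lborel (\<lambda>x::real ^ 'n. indicator (cball 0 R) x * (C * (2 * real J / R) powr K))"
      by (intro integrable_mult_left integrable_real_indicator)
         (simp_all add: emeasure_compact_finite[OF compact_cball, unfolded infinity_ennreal_def])
    have "(\<integral>x. c * (cutoff R J x * v x powr (\<kappa> + p))
        - indicator (cball 0 R) x * (C * (2 * real J / R) powr K) \<partial>lborel) \<le> (\<integral>x. I1 x + I2 x \<partial>lborel)"
      using intL intR int1 int2 below by (intro integral_mono) auto
    then have "c * (\<integral>x. cutoff R J x * v x powr (\<kappa> + p) \<partial>lborel)
        - measure lborel (cball (0::real ^ 'n) R) * (C * (2 * real J / R) powr K) \<le> 0"
      using intL intR unfolding zero by simp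
    then show ?thesis by (simp add: mult.commute)
  qed
  then have "\<forall>R J. R > 0 \<longrightarrow> real J \<ge> K \<longrightarrow>
    (\<integral>x. cutoff R J x * v x powr (\<kappa> + p) \<partial>lborel)
      \<le> (C / c) * (2 * real J / R) powr K * measure lborel (cball (0::real ^ 'n) R)"
    using c by (simp add: field_simps)
  then show ?thesis by blast
qed

text \<open>The energy on the unit ball is at most a multiple of \<open>R\<^sup>n\<^sup>-\<^sup>K\<close>, hence of \<open>1 / R\<close>, for every \<open>R \<ge> 1\<close>.\<close>

lemma no_positive_solution:
  fixes v :: "real ^ 'n::finite \<Rightarrow> real"
  assumes dim: "n = real CARD('n)"
    and v: "has_cont_grad v G" and H: "\<And>i. has_cont_grad (\<lambda>x. G x $ i) (H i)"
    and pos: "\<And>x. v x > 0"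
    and eq: "\<And>x. (\<Sum>i\<in>UNIV. H i x $ i) = - (v x powr p + M * norm (G x) powr (2 * s))"
  shows False
proof -
  obtain C where C: "\<And>R J. R > 0 \<Longrightarrow> real J \<ge> K \<Longrightarrow>
    (\<integral>x. cutoff R J x * v x powr (\<kappa> + p) \<partial>lborel)
      \<le> C * (2 * real J / R) powr K * measure lborel (cball (0::real ^ 'n) R)"
    using energy_estimate[OF dim v H pos eq] by blast
  define J where "J = nat \<lceil>K\<rceil>"
  have JK: "real J \<ge> K" unfolding J_def by (rule real_nat_ceiling_ge)
  then have J: "J \<ge> 2" using K_ge n by linarith
  define E where "E = (\<lambda>R. \<integral>x. cutoff R J x * v x powr (\<kappa> + p) \<partial>lborel)"
  have cv: "continuous_on UNIV (\<lambda>x. v x powr (\<kappa> + p))"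
    using pos by (intro continuous_on_powr has_cont_gradD[OF v] continuous_intros) (metis less_irrefl)
  have cont: "continuous_on UNIV (\<lambda>x. cutoff R J x * v x powr (\<kappa> + p))" for R
    by (intro continuous_on_mult cv has_cont_gradD(3)[OF has_cont_grad_cutoff[OF J]])
  have int: "integrable lborel (\<lambda>x. cutoff R J x * v x powr (\<kappa> + p))" if "R > 0" for R
    by (rule integrable_compact_support[OF cont, where R = R]) (use that J in \<open>simp add: cutoff_eq_0\<close>)
  have "E 1 > 0"
    unfolding E_def
  proof (rule integral_pos_of_continuous[OF cont int])
    show "cutoff 1 J x * v x powr (\<kappa> + p) \<ge> 0" for x
      by (simp add: cutoff_nonneg)
    show "cutoff 1 J 0 * v 0 powr (\<kappa> + p) > 0"
      using pos[of 0] by (simp add: cutoff_def)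
  qed simp
  have mono: "E 1 \<le> E R" if "R \<ge> 1" for R
    unfolding E_def
  proof (rule integral_mono)
    show "cutoff 1 J x * v x powr (\<kappa> + p) \<le> cutoff R J x * v x powr (\<kappa> + p)" for x
    proof (rule mult_right_mono)
      have "1 \<le> R\<^sup>2" using that by (simp add: one_le_power)
      then have "(norm x)\<^sup>2 / R\<^sup>2 \<le> (norm x)\<^sup>2 / 1\<^sup>2"
        by (intro divide_left_mono) auto
      then show "cutoff 1 J x \<le> cutoff R J x"
        unfolding cutoff_def by (intro power_mono max.mono) auto
    qed simp
  qed (use int that in auto)
  define B where "B = \<bar>C\<bar> * (2 * real J) powr K * unit_ball_vol (real DIM(real ^ 'n))"
  have "E 1 \<le> B / R" if R: "R \<ge> 1" for R
  proof -
    define U where "U = unit_ball_vol (real DIM(real ^ 'n))"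
    have "U \<ge> 0" by (simp add: U_def)
    have meas: "measure lborel (cball (0::real ^ 'n) R) = U * R powr n"
      using R content_cball[of R "0::real ^ 'n"] by (simp add: dim powr_realpow U_def)
    have "E 1 \<le> E R" by (rule mono[OF R])
    also have "\<dots> \<le> C * (2 * real J / R) powr K * (U * R powr n)"
      using C[OF _ JK, of R] R unfolding E_def meas by simp
    also have "\<dots> \<le> \<bar>C\<bar> * (2 * real J / R) powr K * (U * R powr n)"
      using \<open>U \<ge> 0\<close> by (intro mult_right_mono) auto
    also have "\<dots> = B * (R powr n / R powr K)"
      using R by (simp add: B_def U_def powr_divide)
    also have "R powr n / R powr K = R powr (n - K)" by (simp add: powr_diff)
    also have "B * R powr (n - K) \<le> B * R powr (- 1)"
    proof (rule mult_left_mono)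
      show "R powr (n - K) \<le> R powr (- 1)" using R K_ge by (intro powr_mono) auto
      show "0 \<le> B" by (simp add: B_def)
    qed
    finally show ?thesis using R by (simp add: powr_minus_divide)
  qed
  note bound = this
  define R where "R = max 1 (2 * B / E 1)"
  have "R \<ge> 1" by (simp add: R_def)
  have "2 * B / E 1 \<le> R" by (simp add: R_def)
  then have "2 * B \<le> R * E 1" using \<open>E 1 > 0\<close> by (simp add: divide_le_eq)
  moreover have "E 1 * R \<le> B" using bound[OF \<open>R \<ge> 1\<close>] \<open>R \<ge> 1\<close> by (simp add: le_divide_eq)
  moreover have "R * E 1 > 0" using \<open>R \<ge> 1\<close> \<open>E 1 > 0\<close> by simp
  ultimately show False by (simp add: mult.commute)
qed

end

section \<open>The Liouville theorem\<close>

lemma zero_classical_solution: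
  assumes "\<And>x. v x = 0" and "0 < q"
  shows "classical_solution p q M (v :: real ^ 'n::finite \<Rightarrow> real)"
proof -
  have v: "v = (\<lambda>_. 0)" using assms by auto
  have d: "partial_deriv i (\<lambda>_. 0) = (\<lambda>_::real ^ 'n. 0)" for i
    by (rule ext) (simp add: partial_deriv_eq[OF has_derivative_const])
  have g: "grad (\<lambda>_::real ^ 'n. 0) x = 0" for x
    by (simp add: grad_def d vec_eq_iff)
  show ?thesis
    unfolding classical_solution_def C2_def v laplacian_def g
    by (simp add: d)
qed

theorem theorem1p4:
  fixes p q M :: real and v :: "real ^ 'n::finite \<Rightarrow> real"
  assumes "CARD('n) \<ge> 3"
    and "1 < p" and "p \<le> (real CARD('n) + 2) / (real CARD('n) - 2)"
    and "q = 2 * p / (p + 1)"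
    and "M > 0"
  shows "classical_solution p q M v \<and> (\<forall>x. v x \<ge> 0) \<longleftrightarrow> (\<forall>x. v x = 0)"
proof
  assume zero: "\<forall>x. v x = 0"
  then show "classical_solution p q M v \<and> (\<forall>x. v x \<ge> 0)"
    using assms by (auto intro!: zero_classical_solution)
next
  assume sol: "classical_solution p q M v \<and> (\<forall>x. v x \<ge> 0)"
  have crit: "p * (real CARD('n) - 2) \<le> real CARD('n) + 2"
    using assms(1,3) by (simp add: le_divide_eq)
  interpret exponents "real CARD('n)" p M
    by unfold_locales (use assms crit in auto)
  define H where "H = (\<lambda>i. grad (partial_deriv i v))"
  have v: "has_cont_grad v (grad v)" and H: "has_cont_grad (\<lambda>x. grad v x $ i) (H i)" for i
    using sol by (auto simp: classical_solution_def H_def intro: C2_imp_has_cont_grad)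
  have "laplacian v x + v x powr p + M * norm (grad v x) powr q = 0" for x
    using sol by (simp only: classical_solution_def)
  then have "laplacian v x = - (v x powr p + M * norm (grad v x) powr q)" for x
    by (simp add: algebra_simps eq_neg_iff_add_eq_0)
  moreover have "(\<Sum>i\<in>UNIV. H i x $ i) = laplacian v x" for x
    by (simp add: H_def grad_def laplacian_def)
  moreover have "2 * s = q" using assms by (simp add: s_def)
  ultimately have eq: "(\<Sum>i\<in>UNIV. H i x $ i) = - (v x powr p + M * norm (grad v x) powr (2 * s))" for x
    by (simp only:)
  have super: "(\<Sum>i\<in>UNIV. H i x $ i) \<le> 0" for x
  proof -
    have "0 \<le> v x powr p + M * norm (grad v x) powr (2 * s)"
      using assms by (intro add_nonneg_nonneg mult_nonneg_nonneg) auto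
    then show ?thesis unfolding eq neg_le_0_iff_le .
  qed
  show "\<forall>x. v x = 0"
  proof (rule ccontr)
    assume "\<not> (\<forall>x. v x = 0)"
    then have "v x \<noteq> 0" for x
      using strong_minimum_principle[OF v H super] sol by blast
    then have "v x > 0" for x
      using sol by (simp add: order_less_le)
    then show False
      using no_positive_solution[OF refl v H _ eq] by blast
  qed
qed

end
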